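(* Let $H\in(0,\frac12)\cup(\frac12,1)$, $\alpha\in\mathbb R$, $\sigma>0$, $x\ge0$, and let $X$ be the strong solution to the Skorohod equation $$dX_t=-\alpha X_t\,dt+\sigma\,dW_t^H+dL_t,\qquad X_0=x,$$ where $L$ is the minimal non-decreasing process (keeping $X\ge0$). Then $X$ is $(H-)$-Hölder continuous, i.e. on every interval $[0,T]$ its paths are almost surely Hölder continuous of order $H-\epsilon$ for every $\epsilon\in(0,H)$. Moreover, for every $T>0$ and $\epsilon\in(0,H)$ there exists $\lambda_0>0$ depending on $T$, $H$ and $\epsilon$ (for the given fixed $\alpha,\sigma,x$) such that $$\mathbb E\exp\big(\lambda_0\|X\|_{\infty,T}^2\big)<\infty\quad\text{and}\quad \mathbb E\exp\big(\lambda_0\|X\|_{H-\epsilon,T}^2\big)<\infty.$$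
   Context: $W^H$ is a standard fractional Brownian motion with Hurst parameter $H$, i.e. a centered Gaussian process with covariance $\frac12(t^{2H}+s^{2H}-|t-s|^{2H})$. In the Skorohod equation, $X_t\ge0$ for all $t\ge0$, and $L$ is the minimal non-decreasing, non-negative process with $L_0=0$ that increases only when $X=0$, i.e. $\int_{[0,\infty)}I(X_t>0)\,dL_t=0$; the equation has a unique pathwise solution. For a function $y$ on $[0,T]$ and $\beta\in(0,1)$: $\|y\|_{\beta,T}=\sup_{0\le\theta<r\le T}\frac{|y_r-y_\theta|}{|r-\theta|^\beta}$ and $\|y\|_{\infty,T}=\sup_{0\le r\le T}|y_r|$. *)

theory Defs
  imports "HOL-Probability.Probability"
begin

section \<open>Fractional Brownian motion\<close>

text \<open>A point mass counts as Gaussian (\<open>s = 0\<close>): linear combinations of a Gaussian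
  process may degenerate, and fractional Brownian motion itself vanishes at time 0.\<close>

definition gaussian_rv :: "'a measure \<Rightarrow> ('a \<Rightarrow> real) \<Rightarrow> bool" where
  "gaussian_rv M Y \<longleftrightarrow> Y \<in> borel_measurable M \<and>
     (\<exists>\<mu> s. 0 \<le> s \<and>
        distr M borel Y =
          (if s = 0 then return borel \<mu> else density lborel (normal_density \<mu> s)))"

definition gaussian_process ::
    "'a measure \<Rightarrow> 'i set \<Rightarrow> ('i \<Rightarrow> 'a \<Rightarrow> real) \<Rightarrow> bool" where
  "gaussian_process M I Y \<longleftrightarrow>
     (\<forall>J c. finite J \<and> J \<subseteq> I \<longrightarrow> gaussian_rv M (\<lambda>\<omega>. \<Sum>i\<in>J. c i * Y i \<omega>))"

definition covariance :: "'a measure \<Rightarrow> ('a \<Rightarrow> real) \<Rightarrow> ('a \<Rightarrow> real) \<Rightarrow> real" where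
  "covariance M Y Z =
     (\<integral>\<omega>. (Y \<omega> - (\<integral>\<omega>'. Y \<omega>' \<partial>M)) * (Z \<omega> - (\<integral>\<omega>'. Z \<omega>' \<partial>M)) \<partial>M)"

text \<open>As usual, fractional Brownian motion means the version with almost surely continuous
  paths; a pathwise equation driven by it makes no sense otherwise. The time index is
  \<open>{0..}\<close>; values at negative times are irrelevant.\<close>

definition fractional_brownian_motion ::
    "real \<Rightarrow> 'a measure \<Rightarrow> (real \<Rightarrow> 'a \<Rightarrow> real) \<Rightarrow> bool" where
  "fractional_brownian_motion H M W \<longleftrightarrow>
     prob_space M \<and>
     gaussian_process M {0..} W \<and>
     (\<forall>t\<ge>0. (\<integral>\<omega>. W t \<omega> \<partial>M) = 0) \<and>
     (\<forall>s\<ge>0. \<forall>t\<ge>0. covariance M (W s) (W t) =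
        (t powr (2 * H) + s powr (2 * H) - \<bar>t - s\<bar> powr (2 * H)) / 2) \<and>
     (AE \<omega> in M. continuous_on {0..} (\<lambda>t. W t \<omega>))"

section \<open>The Skorohod equation\<close>

text \<open>Pathwise equation with driving path \<open>w\<close>, solution path \<open>y\<close> and reflection path \<open>l\<close>.
  Right-continuity of \<open>l\<close> is what makes \<open>dl\<close> a Lebesgue-Stieltjes measure; \<open>l\<close> is extended
  by \<open>l 0 = 0\<close> to negative times in order to use the library's measure on the whole line.
  The last conjunct is the minimality of \<open>l\<close>: here \<open>y - l\<close> is the unreflected part
  \<open>x - \<alpha> * (LBINT s:{0..t}. y s) + \<sigma> * w t\<close>, and \<open>l\<close> is the smallest non-decreasing
  function starting at 0 which, added to that part, keeps it non-negative. (By Skorohod's lemma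
  minimality already follows from the other conditions.)\<close>

definition skorohod_path ::
    "real \<Rightarrow> real \<Rightarrow> real \<Rightarrow> (real \<Rightarrow> real) \<Rightarrow> (real \<Rightarrow> real) \<Rightarrow> (real \<Rightarrow> real) \<Rightarrow> bool" where
  "skorohod_path \<alpha> \<sigma> x w y l \<longleftrightarrow>
     y 0 = x \<and>
     (\<forall>t\<ge>0. set_integrable lborel {0..t} y \<and>
             y t = x - \<alpha> * (LBINT s:{0..t}. y s) + \<sigma> * w t + l t) \<and>
     (\<forall>t\<ge>0. 0 \<le> y t) \<and>
     l 0 = 0 \<and> (\<forall>t\<ge>0. 0 \<le> l t) \<and> mono_on {0..} l \<and>
     (\<forall>t\<ge>0. continuous (at_right t) l) \<and>
     (\<integral>\<^sup>+t\<in>{0..}. indicator {t. 0 < y t} t \<partial>interval_measure (\<lambda>t. l (max 0 t))) = 0 \<and>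
     (\<forall>l'. l' 0 = 0 \<and> mono_on {0..} l' \<and> (\<forall>t\<ge>0. 0 \<le> y t - l t + l' t)
        \<longrightarrow> (\<forall>t\<ge>0. l t \<le> l' t))"

definition completed_filtration ::
    "'a measure \<Rightarrow> (real \<Rightarrow> 'a \<Rightarrow> real) \<Rightarrow> real \<Rightarrow> 'a measure" where
  "completed_filtration M W t =
     sigma (space M)
       ({W s -` A \<inter> space M |s A. s \<in> {0..t} \<and> A \<in> sets borel} \<union> null_sets (completion M))"

definition strong_solution ::
    "real \<Rightarrow> real \<Rightarrow> real \<Rightarrow> 'a measure \<Rightarrow>
     (real \<Rightarrow> 'a \<Rightarrow> real) \<Rightarrow> (real \<Rightarrow> 'a \<Rightarrow> real) \<Rightarrow> (real \<Rightarrow> 'a \<Rightarrow> real) \<Rightarrow> bool" where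
  "strong_solution \<alpha> \<sigma> x M W X L \<longleftrightarrow>
     (\<forall>t\<ge>0. X t \<in> borel_measurable (completed_filtration M W t) \<and>
             L t \<in> borel_measurable (completed_filtration M W t)) \<and>
     (AE \<omega> in M. skorohod_path \<alpha> \<sigma> x (\<lambda>t. W t \<omega>) (\<lambda>t. X t \<omega>) (\<lambda>t. L t \<omega>))"

section \<open>Path norms and expectations\<close>

definition hoelder_continuous_on :: "real set \<Rightarrow> real \<Rightarrow> (real \<Rightarrow> real) \<Rightarrow> bool" where
  "hoelder_continuous_on S \<beta> y \<longleftrightarrow>
     (\<exists>C. \<forall>s\<in>S. \<forall>t\<in>S. \<bar>y t - y s\<bar> \<le> C * \<bar>t - s\<bar> powr \<beta>)"

text \<open>The norms take values in \<open>ennreal\<close>, so an unbounded supremum is \<open>\<infinity>\<close> rather than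
  the unspecified value of \<open>Sup\<close> on unbounded sets of reals.\<close>

definition sup_norm :: "real \<Rightarrow> (real \<Rightarrow> real) \<Rightarrow> ennreal" where
  "sup_norm T y = (SUP r\<in>{0..T}. ennreal \<bar>y r\<bar>)"

definition hoelder_norm :: "real \<Rightarrow> real \<Rightarrow> (real \<Rightarrow> real) \<Rightarrow> ennreal" where
  "hoelder_norm \<beta> T y =
     (SUP (\<theta>, r)\<in>{(\<theta>, r). 0 \<le> \<theta> \<and> \<theta> < r \<and> r \<le> T}.
        ennreal (\<bar>y r - y \<theta>\<bar> / \<bar>r - \<theta>\<bar> powr \<beta>))"

definition exp_ennreal :: "ennreal \<Rightarrow> ennreal" where
  "exp_ennreal a = (if a = \<infinity> then \<infinity> else ennreal (exp (enn2real a)))"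

text \<open>Since path properties hold only almost surely, functionals of whole paths are measurable
  only with respect to the completed measure; for complete \<open>M\<close> this is \<open>M\<close> itself.\<close>

definition finite_expectation :: "'a measure \<Rightarrow> ('a \<Rightarrow> ennreal) \<Rightarrow> bool" where
  "finite_expectation M f \<longleftrightarrow>
     f \<in> borel_measurable (completion M) \<and> (\<integral>\<^sup>+\<omega>. f \<omega> \<partial>completion M) < \<infinity>"

end

theory Submission
  imports Defs
begin

text \<open>Minimality of the reflection path bounds its increments, and hence those of the solution, by
  the oscillation of the unreflected part; with Gronwall's inequality both norms of the solution
  are then at most affine in the Hoelder constant \<open>N\<close> of the driving path. For fractional Brownian
  motion, let \<open>S\<close> be the sum of \<open>exp (\<Delta>\<^sup>2 / (4 v) - n)\<close> over all dyadic increments \<open>\<Delta>\<close> of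
  all levels \<open>n\<close>, where \<open>v\<close> is the variance of \<open>\<Delta>\<close>. Its expectation is finite because each
  \<open>exp (\<Delta>\<^sup>2 / (4 v))\<close> has expectation \<open>sqrt 2\<close>, and since every summand is at most \<open>S\<close>, chaining
  gives \<open>N\<^sup>2 \<le> a + b * ln (1 + S)\<close>. So \<open>exp (\<kappa> * N\<^sup>2)\<close> is dominated by a multiple of
  \<open>1 + S\<close> as soon as \<open>\<kappa> * b \<le> 1\<close>.\<close>

section \<open>Dyadic chaining\<close>

lemma dyadic_floor_step:
  fixes u :: real
  shows "\<lfloor>2 ^ Suc n * u\<rfloor> = 2 * \<lfloor>2 ^ n * u\<rfloor> \<or> \<lfloor>2 ^ Suc n * u\<rfloor> = 2 * \<lfloor>2 ^ n * u\<rfloor> + 1"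
proof -
  have "2 ^ Suc n * u = 2 * (2 ^ n * u)" by simp
  then show ?thesis by linarith
qed

lemma dyadic_approx_tendsto:
  fixes u :: real
  shows "(\<lambda>n. real_of_int \<lfloor>2 ^ n * u\<rfloor> / 2 ^ n) \<longlonglongrightarrow> u"
proof (rule tendsto_sandwich)
  show "\<forall>\<^sub>F n in sequentially. u - (1/2) ^ n \<le> real_of_int \<lfloor>2 ^ n * u\<rfloor> / 2 ^ n"
  proof (intro always_eventually allI)
    fix n
    have "2 ^ n * u - 1 \<le> real_of_int \<lfloor>2 ^ n * u\<rfloor>" by linarith
    then have "(2 ^ n * u - 1) / 2 ^ n \<le> real_of_int \<lfloor>2 ^ n * u\<rfloor> / 2 ^ n"
      by (intro divide_right_mono) auto
    then show "u - (1/2) ^ n \<le> real_of_int \<lfloor>2 ^ n * u\<rfloor> / 2 ^ n"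
      by (simp add: diff_divide_distrib power_one_over)
  qed
  show "\<forall>\<^sub>F n in sequentially. real_of_int \<lfloor>2 ^ n * u\<rfloor> / 2 ^ n \<le> u"
    by (intro always_eventually allI) (simp add: divide_le_eq mult.commute)
  have "(\<lambda>n. u - (1/2::real) ^ n) \<longlonglongrightarrow> u - 0"
    by (intro tendsto_intros LIMSEQ_power_zero) auto
  then show "(\<lambda>n. u - (1/2::real) ^ n) \<longlonglongrightarrow> u" by simp
qed auto

text \<open>The dyadic truncations of \<open>u\<close> converge to \<open>u\<close>, and from one
  level to the next they either stay put or cross one cell of the finer grid. The increments beyond
  level \<open>n\<close> therefore form a geometric tail with ratio \<open>q\<close>, and continuity
  carries the bound to the limit.\<close>

lemma dyadic_chaining_tail:
  fixes w :: "real \<Rightarrow> real" and q A u :: real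
  assumes cont: "continuous_on {0..1} w" and q: "0 < q" "q < 1" and A: "0 \<le> A"
    and inc: "\<And>n k. k < 2 ^ n \<Longrightarrow> \<bar>w (real (Suc k) / 2 ^ n) - w (real k / 2 ^ n)\<bar> \<le> A * q ^ n"
    and u: "0 \<le> u" "u \<le> 1"
  shows "\<bar>w u - w (real_of_int \<lfloor>2 ^ n * u\<rfloor> / 2 ^ n)\<bar> \<le> A * q ^ n * (q / (1 - q))"
proof -
  define d where "d n = real_of_int \<lfloor>2 ^ n * u\<rfloor> / 2 ^ n" for n
  have d01: "d n \<in> {0..1}" for n
  proof -
    have "real_of_int \<lfloor>2 ^ n * u\<rfloor> \<le> 2 ^ n * u" by simp
    also have "\<dots> \<le> 2 ^ n" using u by simp
    finally show ?thesis using u unfolding d_def by (simp add: divide_le_eq)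
  qed
  have step: "\<bar>w (d (Suc n)) - w (d n)\<bar> \<le> A * q ^ Suc n" for n
  proof -
    consider "\<lfloor>2 ^ Suc n * u\<rfloor> = 2 * \<lfloor>2 ^ n * u\<rfloor>" | "\<lfloor>2 ^ Suc n * u\<rfloor> = 2 * \<lfloor>2 ^ n * u\<rfloor> + 1"
      using dyadic_floor_step by blast
    then show ?thesis
    proof cases
      case 1
      then have "d (Suc n) = d n" by (simp add: d_def)
      then show ?thesis using A q by simp
    next
      case 2
      \<comment> \<open>Here \<open>d n\<close> and \<open>d (Suc n)\<close> are the two ends of
        cell number \<open>k\<close> of level \<open>Suc n\<close>; \<open>d (Suc n) \<le> 1\<close>
        shows that the cell belongs to the grid.\<close>
      define k where "k = nat (2 * \<lfloor>2 ^ n * u\<rfloor>)"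
      have nn: "0 \<le> \<lfloor>2 ^ n * u\<rfloor>" using u by simp
      have rk: "real k = 2 * real_of_int \<lfloor>2 ^ n * u\<rfloor>"
        using nn by (simp add: k_def)
      have dn: "d n = real k / 2 ^ Suc n" by (simp add: d_def rk)
      have dS: "d (Suc n) = real (Suc k) / 2 ^ Suc n" using 2 by (simp add: d_def rk)
      have "d (Suc n) \<le> 1" using d01 by auto
      then have "real (Suc k) \<le> 2 ^ Suc n" unfolding dS by (simp add: divide_le_eq)
      then have "Suc k \<le> 2 ^ Suc n" using of_nat_le_iff[of "Suc k" "2 ^ Suc n", where 'a=real] by simp
      then have "k < 2 ^ Suc n" by simp
      from inc[OF this] show ?thesis unfolding dn dS .
    qed
  qed
  \<comment> \<open>The partial geometric sum is stated in closed form, so that each induction step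
    adds exactly the difference of two consecutive bounds.\<close>
  have tele: "\<bar>w (d (n + m)) - w (d n)\<bar> \<le> A * (q / (1 - q)) * (q ^ n - q ^ (n + m))" for m
  proof (induction m)
    case (Suc m)
    have "A * q ^ Suc (n + m) = A * (q / (1 - q)) * (q ^ (n + m) - q ^ Suc (n + m))"
      using q by (simp add: divide_simps) (simp add: algebra_simps)
    then show ?case using Suc.IH step[of "n + m"] by (simp add: right_diff_distrib)
  qed simp
  have "q / (1 - q) \<ge> 0" using q by simp
  then have "A * (q / (1 - q)) * (q ^ n - q ^ (n + m)) \<le> A * (q / (1 - q)) * q ^ n" for m
    using A q by (intro mult_left_mono mult_nonneg_nonneg) auto
  then have b: "\<bar>w (d (n + m)) - w (d n)\<bar> \<le> A * (q / (1 - q)) * q ^ n" for m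
    using tele order_trans by blast
  have "(\<lambda>m. d (n + m)) \<longlonglongrightarrow> u"
    using LIMSEQ_ignore_initial_segment[OF dyadic_approx_tendsto[of u], of n]
    by (simp add: d_def add.commute)
  then have "(\<lambda>m. w (d (n + m))) \<longlonglongrightarrow> w u"
    using cont u d01 unfolding continuous_on_sequentially by (auto simp: o_def)
  then have "(\<lambda>m. \<bar>w (d (n + m)) - w (d n)\<bar>) \<longlonglongrightarrow> \<bar>w u - w (d n)\<bar>"
    by (intro tendsto_intros)
  then have "\<bar>w u - w (d n)\<bar> \<le> A * (q / (1 - q)) * q ^ n"
    by (rule LIMSEQ_le_const2) (use b in blast)
  then show ?thesis by (simp add: d_def ac_simps)
qed

text \<open>With \<open>q = 2 powr -\<beta>\<close>, the first factor counts one increment between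
  neighbouring grid points and two tails \<open>q / (1 - q)\<close>; \<open>2 powr \<beta>\<close>
  is the price of replacing the mesh \<open>1 / 2 ^ n\<close> by \<open>t - s\<close>.\<close>

definition chaining_const :: "real \<Rightarrow> real" where
  "chaining_const \<beta> = (1 + 2 * (2 powr -\<beta> / (1 - 2 powr -\<beta>))) * 2 powr \<beta>"

lemma chaining_const_pos: "0 < \<beta> \<Longrightarrow> 0 < chaining_const \<beta>"
  unfolding chaining_const_def
  using powr_less_one[of 2 "-\<beta>"]
  by (intro mult_pos_pos add_pos_nonneg) (auto intro!: divide_nonneg_nonneg)

text \<open>At the level whose mesh is comparable to \<open>t - s\<close>, the truncations of
  \<open>s\<close> and \<open>t\<close> coincide or are neighbours, so the increment of
  \<open>w\<close> splits into at most one grid increment and two tails.\<close>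

lemma dyadic_chaining_unit:
  fixes w :: "real \<Rightarrow> real" and A \<beta> s t :: real
  assumes cont: "continuous_on {0..1} w" and \<beta>: "0 < \<beta>" and A: "0 \<le> A"
    and inc: "\<And>n k. k < 2 ^ n \<Longrightarrow>
      \<bar>w (real (Suc k) / 2 ^ n) - w (real k / 2 ^ n)\<bar> \<le> A * (1 / 2 ^ n) powr \<beta>"
    and st: "0 \<le> s" "s < t" "t \<le> 1"
  shows "\<bar>w t - w s\<bar> \<le> chaining_const \<beta> * A * (t - s) powr \<beta>"
proof -
  define q where "q = (2::real) powr -\<beta>"
  have q: "0 < q" "q < 1" using \<beta> by (auto simp: q_def powr_less_one)
  have qn: "(1 / 2 ^ n) powr \<beta> = q ^ n" for n :: nat
    by (simp add: q_def powr_realpow[symmetric] powr_powr powr_minus[symmetric] mult.commute powr_divide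
        flip: inverse_eq_divide)
  have inc': "\<And>n k. k < 2 ^ n \<Longrightarrow> \<bar>w (real (Suc k) / 2 ^ n) - w (real k / 2 ^ n)\<bar> \<le> A * q ^ n"
    using inc unfolding qn .
  \<comment> \<open>\<open>Suc n\<close> is the least exponent for which the power of 1/2 falls
    below \<open>t - s\<close>; it is not 0 because \<open>t - s \<le> 1\<close>. The upper bound on
    \<open>t - s\<close> makes the truncations neighbours; the lower one gives
    \<open>1 / 2 ^ n < 2 * (t - s)\<close>, used in the final comparison.\<close>
  obtain n :: nat where n: "(1/2) ^ Suc n < t - s" "t - s \<le> (1/2) ^ n"
  proof -
    define P where "P k \<longleftrightarrow> (1/2) ^ k < t - s" for k
    have ex: "\<exists>k. P k" unfolding P_def using st real_arch_pow_inv[of "t - s" "1/2"] by auto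
    have "\<not> P 0" unfolding P_def using st by simp
    then obtain m where "Least P = Suc m" using LeastI_ex[OF ex] by (metis not0_implies_Suc)
    then show ?thesis using that[of m] LeastI_ex[OF ex] not_less_Least[of m P]
      unfolding P_def by auto
  qed
  define i where "i = \<lfloor>2 ^ n * s\<rfloor>"
  define j where "j = \<lfloor>2 ^ n * t\<rfloor>"
  have "2 ^ n * (t - s) \<le> 1" using n(2) by (simp add: power_one_over field_simps)
  then have "2 ^ n * t \<le> 2 ^ n * s + 1" by (simp add: algebra_simps)
  moreover have "2 ^ n * s \<le> 2 ^ n * t" using st by simp
  ultimately have ij: "j = i \<or> j = i + 1" unfolding i_def j_def by linarith
  have mid: "\<bar>w (real_of_int j / 2 ^ n) - w (real_of_int i / 2 ^ n)\<bar> \<le> A * q ^ n"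
    using ij
  proof
    assume "j = i" then show ?thesis using A q by simp
  next
    assume j: "j = i + 1"
    have i0: "0 \<le> i" using st by (simp add: i_def)
    have "real_of_int j \<le> 2 ^ n * t" unfolding j_def by simp
    also have "\<dots> \<le> 2 ^ n" using st by simp
    finally have "real_of_int i + 1 \<le> 2 ^ n" using j by simp
    moreover have "real (nat i) = real_of_int i" using i0 by simp
    ultimately have "real (nat i) < 2 ^ n" by linarith
    then have "nat i < 2 ^ n" using of_nat_less_iff[of "nat i" "2 ^ n", where 'a=real] by simp
    from inc'[OF this] show ?thesis using j i0 by (simp add: add.commute)
  qed
  have "\<bar>w t - w s\<bar> \<le> A * q ^ n * (q / (1 - q)) + A * q ^ n + A * q ^ n * (q / (1 - q))"
    using mid
      dyadic_chaining_tail[OF cont q A inc', of s n]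
      dyadic_chaining_tail[OF cont q A inc', of t n] st
    unfolding i_def j_def by linarith
  also have "\<dots> = (1 + 2 * (q / (1 - q))) * A * q ^ n" by (simp add: algebra_simps)
  also have "\<dots> \<le> (1 + 2 * (q / (1 - q))) * A * (2 powr \<beta> * (t - s) powr \<beta>)"
  proof (intro mult_left_mono mult_nonneg_nonneg A)
    have "(1 / 2 ^ n) powr \<beta> \<le> (2 * (t - s)) powr \<beta>"
      using n(1) st \<beta> by (intro powr_mono2) (auto simp: power_one_over)
    also have "\<dots> = 2 powr \<beta> * (t - s) powr \<beta>"
      by (rule powr_mult)
    finally show "q ^ n \<le> 2 powr \<beta> * (t - s) powr \<beta>"
      unfolding qn .
  qed (use q in auto)
  finally show ?thesis by (simp add: chaining_const_def q_def ac_simps)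
qed

lemma dyadic_chaining:
  fixes w :: "real \<Rightarrow> real" and A \<beta> T s t :: real
  assumes cont: "continuous_on {0..T} w" and T: "0 < T" and \<beta>: "0 < \<beta>" and A: "0 \<le> A"
    and inc: "\<And>n k. k < 2 ^ n \<Longrightarrow>
      \<bar>w (T * real (Suc k) / 2 ^ n) - w (T * real k / 2 ^ n)\<bar> \<le> A * (T / 2 ^ n) powr \<beta>"
    and st: "s \<in> {0..T}" "t \<in> {0..T}"
  shows "\<bar>w t - w s\<bar> \<le> chaining_const \<beta> * A * \<bar>t - s\<bar> powr \<beta>"
proof -
  have less: "\<bar>w t - w s\<bar> \<le> chaining_const \<beta> * A * (t - s) powr \<beta>"
    if st: "0 \<le> s" "s < t" "t \<le> T" for s t
  proof -
    \<comment> \<open>Rescaling to the unit interval multiplies the constant by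
      \<open>T powr \<beta>\<close>, which cancels against the denominator of
      \<open>((t - s) / T) powr \<beta>\<close>.\<close>
    have "\<bar>w (T * (t / T)) - w (T * (s / T))\<bar> \<le>
        chaining_const \<beta> * (A * T powr \<beta>) * (t / T - s / T) powr \<beta>"
    proof (rule dyadic_chaining_unit[where w = "\<lambda>u. w (T * u)"])
      show "continuous_on {0..1} (\<lambda>u. w (T * u))"
        by (rule continuous_on_compose2[OF cont]) (use T in \<open>auto intro!: continuous_intros simp: mult_left_le\<close>)
      fix n k :: nat assume "k < 2 ^ n"
      from inc[OF this] show "\<bar>w (T * (real (Suc k) / 2 ^ n)) - w (T * (real k / 2 ^ n))\<bar>
          \<le> A * T powr \<beta> * (1 / 2 ^ n) powr \<beta>"
        using T by (simp add: powr_divide)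
    qed (use that T \<beta> A in \<open>auto simp: divide_strict_right_mono\<close>)
    also have "t / T - s / T = (t - s) / T" by (simp add: diff_divide_distrib)
    finally show ?thesis using T st by (simp add: powr_divide)
  qed
  show ?thesis
    using less[of s t] less[of t s] st by (cases s t rule: linorder_cases) (auto simp: abs_minus_commute)
qed

section \<open>Pathwise bounds for the Skorohod equation\<close>

text \<open>Since \<open>y s \<ge> 0\<close>, a push of size \<open>m\<close> compensates every drop
  of the unreflected part after time \<open>s\<close> that is at most \<open>m\<close>, and the
  minimal reflection cannot push more.\<close>

lemma skorohod_path_reflection_increment:
  assumes sk: "skorohod_path \<alpha> \<sigma> x w y l" and st: "0 \<le> s" "s \<le> t" and m0: "0 \<le> m"
    and m: "\<And>u. s \<le> u \<Longrightarrow> u \<le> t \<Longrightarrow> (y s - l s) - (y u - l u) \<le> m"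
  shows "l t - l s \<le> m"
proof -
  have l0: "l 0 = 0" and mono: "mono_on {0..} l" and lnn: "\<And>t. 0 \<le> t \<Longrightarrow> 0 \<le> l t"
    and ynn: "\<And>t. 0 \<le> t \<Longrightarrow> 0 \<le> y t"
    and minimal: "\<And>l'. l' 0 = 0 \<Longrightarrow> mono_on {0..} l' \<Longrightarrow>
      (\<And>t. 0 \<le> t \<Longrightarrow> 0 \<le> y t - l t + l' t) \<Longrightarrow> (\<And>t. 0 \<le> t \<Longrightarrow> l t \<le> l' t)"
    using sk unfolding skorohod_path_def by blast+
  have lmono: "l u \<le> l v" if "0 \<le> u" "u \<le> v" for u v
    using mono_onD[OF mono, of u v] that by simp
  \<comment> \<open>Minimality is tested against the reflection path capped at \<open>l s + m\<close> up to time \<open>t\<close>.\<close>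
  define l' where "l' r = (if r \<le> t then min (l r) (l s + m) else l r)" for r
  have "l t \<le> l' t"
  proof (rule minimal)
    show "l' 0 = 0" using l0 lnn[of s] st m0 by (simp add: l'_def)
    show "mono_on {0..} l'"
    proof (rule mono_onI)
      fix u v :: real assume "u \<in> {0..}" "v \<in> {0..}" "u \<le> v"
      then show "l' u \<le> l' v"
        using lmono[of u v] by (auto simp: l'_def min_def)
    qed
    show "0 \<le> y r - l r + l' r" if r: "0 \<le> r" for r
    proof -
      consider "r > t" | "r \<le> s" | "s \<le> r" "r \<le> t" by linarith
      then show ?thesis
      proof cases
        case 2
        then have "l' r = l r" using lmono[of r s] r st m0 by (simp add: l'_def)
        then show ?thesis using ynn r by simp
      next
        case 3
        \<comment> \<open>If the cap is active,
          \<open>y r - l r + (l s + m) \<ge> y s \<ge> 0\<close> by the hypothesis on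
          \<open>m\<close>; otherwise \<open>l' r = l r\<close>.\<close>
        then show ?thesis using m[of r] ynn[of r] ynn[of s] r st by (auto simp: l'_def min_def)
      qed (use ynn r in \<open>simp add: l'_def\<close>)
    qed
    show "0 \<le> t" using st by simp
  qed
  then show ?thesis by (simp add: l'_def)
qed

text \<open>The solution is the sum of the unreflected part, which moves by at most
  \<open>m\<close>, and of \<open>l\<close>, whose increment lies between 0 and \<open>m\<close> by
  monotonicity and minimality.\<close>

lemma skorohod_path_oscillation:
  assumes sk: "skorohod_path \<alpha> \<sigma> x w y l" and st: "0 \<le> s" "s \<le> t"
    and m: "\<And>u. s \<le> u \<Longrightarrow> u \<le> t \<Longrightarrow> \<bar>(y u - l u) - (y s - l s)\<bar> \<le> m"
  shows "\<bar>y t - y s\<bar> \<le> 2 * m"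
proof -
  have "mono_on {0..} l" using sk unfolding skorohod_path_def by blast
  then have "l s \<le> l t" using st by (auto dest: mono_onD[where r = s and s = t])
  moreover have "0 \<le> m" using m[of s] st by simp
  then have "l t - l s \<le> m"
    by (rule skorohod_path_reflection_increment[OF sk st]) (use m in \<open>smt (verit)\<close>)
  ultimately show ?thesis using m[of t] st by linarith
qed

section \<open>Integral inequalities and the bounds for the solution path\<close>

lemma set_integral_Icc_split:
  fixes y :: "real \<Rightarrow> real"
  assumes int: "set_integrable lborel {0..u} y" and "0 \<le> s" "s \<le> u"
  shows "(LBINT r:{0..u}. y r) = (LBINT r:{0..s}. y r) + (LBINT r:{s<..u}. y r)"
proof -
  have "(LBINT r:{0..s} \<union> {s<..u}. y r) = (LBINT r:{0..s}. y r) + (LBINT r:{s<..u}. y r)"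
    by (rule set_integral_Un) (use assms in \<open>auto intro: set_integrable_subset[OF int]\<close>)
  moreover have "{0..s} \<union> {s<..u} = {0..u}" using assms by auto
  ultimately show ?thesis by simp
qed

text \<open>In the supremum norm weighted by \<open>exp (- c * s)\<close>, the integral operator has
  norm at most 1/2, so the weighted supremum \<open>S\<close> satisfies
  \<open>S \<le> A + S / 2\<close>. This handles merely integrable, bounded
  \<open>y\<close>.\<close>

lemma gronwall_bounded:
  fixes y :: "real \<Rightarrow> real"
  assumes int: "set_integrable lborel {0..T} y" and B: "0 \<le> B"
    and ynn: "\<And>t. t \<in> {0..T} \<Longrightarrow> 0 \<le> y t" and bdd: "\<And>t. t \<in> {0..T} \<Longrightarrow> y t \<le> M"
    and ineq: "\<And>t. t \<in> {0..T} \<Longrightarrow> y t \<le> A + B * (LBINT s:{0..t}. y s)"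
    and t: "t \<in> {0..T}" and A: "0 \<le> A"
  shows "y t \<le> 2 * A * exp ((2 * B + 1) * t)"
proof -
  \<comment> \<open>The integral of \<open>exp (c * s)\<close> is at most
    \<open>exp (c * u) / c\<close>, so \<open>B / c \<le> 1 / 2\<close> gives the contraction; the
    summand 1 keeps \<open>c\<close> positive when \<open>B = 0\<close>.\<close>
  define c where "c = 2 * B + 1"
  have c: "0 < c" "B / c \<le> 1 / 2" using B by (auto simp: c_def field_simps)
  define S where "S = (SUP s\<in>{0..T}. y s * exp (- c * s))"
  \<comment> \<open>The a priori bound \<open>M\<close> makes \<open>S\<close> a genuine real
    supremum.\<close>
  have bdd_S: "bdd_above ((\<lambda>s. y s * exp (- c * s)) ` {0..T})"
  proof (rule bdd_aboveI2)
    fix s assume s: "s \<in> {0..T}"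
    then have "exp (- c * s) \<le> 1" using c by simp
    then have "y s * exp (- c * s) \<le> y s" using ynn[OF s] by (simp add: mult_left_le)
    then show "y s * exp (- c * s) \<le> M" using bdd[OF s] by simp
  qed
  have yS: "y s \<le> S * exp (c * s)" if "s \<in> {0..T}" for s
  proof -
    have "y s * exp (- c * s) \<le> S" unfolding S_def by (rule cSUP_upper[OF that bdd_S])
    then show ?thesis by (simp add: exp_minus field_simps)
  qed
  have "0 \<le> S * exp (c * t)" using yS[OF t] ynn[OF t] by linarith
  then have S0: "0 \<le> S" by (simp add: zero_le_mult_iff)
  have "y u * exp (- c * u) \<le> A + S / 2" if u: "u \<in> {0..T}" for u
  proof -
    have exp_int: "set_integrable lborel {0..u} (\<lambda>s. S * exp (c * s))"
      by (intro borel_integrable_atLeastAtMost' continuous_intros)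
    have "(LBINT s:{0..u}. y s) \<le> (LBINT s:{0..u}. S * exp (c * s))"
      by (rule set_integral_mono) (use u yS in \<open>auto intro: set_integrable_subset[OF int] exp_int\<close>)
    also have "\<dots> = S * exp (c * u) / c - S * exp (c * 0) / c"
      unfolding set_lebesgue_integral_def real_scaleR_def
      by (subst mult.commute, rule integral_FTC_Icc_real)
         (use u c in \<open>auto intro!: derivative_eq_intros continuous_intros\<close>)
    also have "\<dots> \<le> S * exp (c * u) / c" using S0 c by simp
    finally have "B * (LBINT s:{0..u}. y s) \<le> B * (S * exp (c * u) / c)"
      using B by (rule mult_left_mono)
    also have "\<dots> = (B / c) * (S * exp (c * u))" by simp
    also have "\<dots> \<le> (1 / 2) * (S * exp (c * u))"
      by (rule mult_right_mono) (use c S0 in auto)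
    finally have "y u \<le> A + S / 2 * exp (c * u)" using ineq[OF u] by simp
    then have "y u * exp (- c * u) \<le> (A + S / 2 * exp (c * u)) * exp (- c * u)"
      by (rule mult_right_mono) simp
    also have "\<dots> = A * exp (- c * u) + S / 2" by (simp add: exp_minus field_simps)
    also have "\<dots> \<le> A + S / 2" using A u c by (simp add: mult_left_le)
    finally show ?thesis .
  qed
  then have "S \<le> A + S / 2" unfolding S_def using t by (intro cSUP_least) auto
  then have "S \<le> 2 * A" by simp
  then have "S * exp (c * t) \<le> 2 * A * exp (c * t)" by (rule mult_right_mono) simp
  with yS[OF t] have "y t \<le> 2 * A * exp (c * t)" by (rule order_trans)
  then show ?thesis by (simp only: c_def)
qed

text \<open>The unreflected part oscillates by at most the drift integral plus
  \<open>\<sigma> * N\<close> times a power of the elapsed time, and reflection at most doubles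
  this. From time 0 this is a Gronwall inequality with factor
  \<open>2 * \<bar>\<alpha>\<bar>\<close>, which yields \<open>K\<close>; from time
  \<open>s\<close>, with the drift now bounded by \<open>K\<close>, it is the Hoelder
  estimate.\<close>

lemma skorohod_path_bounds:
  fixes \<alpha> \<sigma> x T \<beta> N :: real
  defines "K \<equiv> 2 * (x + 2 * \<sigma> * N * T powr \<beta>) * exp ((4 * \<bar>\<alpha>\<bar> + 1) * T)"
  assumes sk: "skorohod_path \<alpha> \<sigma> x w y l" and T: "0 < T" and \<beta>: "0 < \<beta>" "\<beta> \<le> 1"
    and N: "0 \<le> N" and \<sigma>: "0 < \<sigma>" and x: "0 \<le> x"
    and w: "\<And>s t. s \<in> {0..T} \<Longrightarrow> t \<in> {0..T} \<Longrightarrow> \<bar>w t - w s\<bar> \<le> N * \<bar>t - s\<bar> powr \<beta>"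
  shows "\<And>t. t \<in> {0..T} \<Longrightarrow> \<bar>y t\<bar> \<le> K"
    and "\<And>s t. s \<in> {0..T} \<Longrightarrow> t \<in> {0..T} \<Longrightarrow>
      \<bar>y t - y s\<bar> \<le> 2 * (\<bar>\<alpha>\<bar> * K * T powr (1 - \<beta>) + \<sigma> * N) * \<bar>t - s\<bar> powr \<beta>"
proof -
  define F where "F t = (LBINT s:{0..t}. y s)" for t
  have y0: "y 0 = x" and l0: "l 0 = 0" and ynn: "\<And>t. 0 \<le> t \<Longrightarrow> 0 \<le> y t"
    using sk unfolding skorohod_path_def by blast+
  have "\<forall>t\<ge>0. set_integrable lborel {0..t} y \<and> y t = x - \<alpha> * F t + \<sigma> * w t + l t"
    using sk unfolding skorohod_path_def F_def by (elim conjE)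
  then have int: "\<And>t. 0 \<le> t \<Longrightarrow> set_integrable lborel {0..t} y"
    and yeq: "\<And>t. 0 \<le> t \<Longrightarrow> y t = x - \<alpha> * F t + \<sigma> * w t + l t"
    by blast+
  have F0: "F 0 = 0"
    unfolding F_def set_lebesgue_integral_def
    by (rule integral_eq_zero_AE, rule AE_mp[OF AE_lborel_singleton[of 0]]) auto
  have Fdiff: "F u - F s = (LBINT r:{s<..u}. y r)" if "0 \<le> s" "s \<le> u" for s u
    unfolding F_def using set_integral_Icc_split[OF int, of u s] that by linarith
  have Fmono: "F s \<le> F u" if "0 \<le> s" "s \<le> u" for s u
  proof -
    have "0 \<le> (LBINT r:{s<..u}. y r)"
      unfolding set_lebesgue_integral_def
      by (rule Bochner_Integration.integral_nonneg) (use ynn that in \<open>auto simp: indicator_def\<close>)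
    then show ?thesis using Fdiff[OF that] by simp
  qed
  have z: "\<bar>(y u - l u) - (y s - l s)\<bar> \<le> \<bar>\<alpha>\<bar> * (F u - F s) + \<sigma> * N * (u - s) powr \<beta>"
    if "0 \<le> s" "s \<le> u" "u \<le> T" for s u
  proof -
    have "(y u - l u) - (y s - l s) = - (\<alpha> * (F u - F s)) + \<sigma> * (w u - w s)"
      using yeq[of u] yeq[of s] that by (simp add: algebra_simps)
    also have "\<bar>\<dots>\<bar> \<le> \<bar>\<alpha> * (F u - F s)\<bar> + \<bar>\<sigma> * (w u - w s)\<bar>" by linarith
    also have "\<bar>\<alpha> * (F u - F s)\<bar> = \<bar>\<alpha>\<bar> * (F u - F s)" using Fmono that by (simp add: abs_mult)
    also have "\<bar>\<sigma> * (w u - w s)\<bar> \<le> \<sigma> * (N * \<bar>u - s\<bar> powr \<beta>)"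
      using w[of s u] that \<sigma> by (simp add: abs_mult)
    finally show ?thesis using that by simp
  qed
  define A where "A = x + 2 * \<sigma> * N * T powr \<beta>"
  have A0: "0 \<le> A" using x \<sigma> N by (simp add: A_def)
  have ineq: "y t \<le> A + 2 * \<bar>\<alpha>\<bar> * F t" if t: "t \<in> {0..T}" for t
  proof -
    have "\<bar>y t - y 0\<bar> \<le> 2 * (\<bar>\<alpha>\<bar> * F t + \<sigma> * N * T powr \<beta>)"
    proof (rule skorohod_path_oscillation[OF sk])
      fix u assume u: "0 \<le> u" "u \<le> t"
      have "\<bar>\<alpha>\<bar> * (F u - F 0) \<le> \<bar>\<alpha>\<bar> * F t" using Fmono[OF u] F0 by (simp add: mult_left_mono)
      moreover have "\<sigma> * N * (u - 0) powr \<beta> \<le> \<sigma> * N * T powr \<beta>"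
        using u t \<sigma> N \<beta> by (intro mult_left_mono powr_mono2) auto
      ultimately show "\<bar>(y u - l u) - (y 0 - l 0)\<bar> \<le> \<bar>\<alpha>\<bar> * F t + \<sigma> * N * T powr \<beta>"
        using z[of 0 u] u t by simp
    qed (use t in auto)
    then show ?thesis using y0 by (simp add: A_def algebra_simps)
  qed
  show bound: "\<bar>y t\<bar> \<le> K" if t: "t \<in> {0..T}" for t
  proof -
    have "y t \<le> 2 * A * exp ((2 * (2 * \<bar>\<alpha>\<bar>) + 1) * t)"
    proof (rule gronwall_bounded[OF int[of T] _ _ _ _ t A0])
      show "y s \<le> A + 2 * \<bar>\<alpha>\<bar> * (LBINT r:{0..s}. y r)" if "s \<in> {0..T}" for s
        using ineq[OF that] by (simp add: F_def)
      \<comment> \<open>The boundedness needed for Gronwall comes from the inequality itself,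
        because \<open>F\<close> is non-decreasing.\<close>
      show "y s \<le> A + 2 * \<bar>\<alpha>\<bar> * F T" if "s \<in> {0..T}" for s
      proof -
        have "2 * \<bar>\<alpha>\<bar> * F s \<le> 2 * \<bar>\<alpha>\<bar> * F T" using Fmono[of s T] that by (intro mult_left_mono) auto
        then show ?thesis using ineq[OF that] by simp
      qed
    qed (use ynn T in auto)
    also have "\<dots> \<le> 2 * A * exp ((4 * \<bar>\<alpha>\<bar> + 1) * T)"
      using t A0 by (intro mult_left_mono) (auto intro!: mult_left_mono)
    finally show ?thesis using ynn[of t] t by (simp add: K_def A_def)
  qed
  have K0: "0 \<le> K" using bound[of 0] T by (meson abs_ge_zero atLeastAtMost_iff less_imp_le order_refl order_trans)
  have FK: "F u - F s \<le> K * (u - s)" if "0 \<le> s" "s \<le> u" "u \<le> T" for s u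
  proof -
    have "(LBINT r:{s<..u}. y r) \<le> (LBINT r:{s<..u}. K)"
    proof (rule set_integral_mono)
      show "set_integrable lborel {s<..u} y"
        by (rule set_integrable_subset[OF int[of u]]) (use that in auto)
      show "y r \<le> K" if "r \<in> {s<..u}" for r
        using bound[of r] that \<open>0 \<le> s\<close> \<open>u \<le> T\<close> by auto
    qed (use \<open>s \<le> u\<close> in \<open>auto simp: set_integrable_def intro!: integrable_mult_left integrable_real_indicator\<close>)
    then show ?thesis using Fdiff that by (simp add: mult.commute set_lebesgue_integral_def)
  qed
  have less: "\<bar>y t - y s\<bar> \<le> 2 * (\<bar>\<alpha>\<bar> * K * T powr (1 - \<beta>) + \<sigma> * N) * (t - s) powr \<beta>"
    if st: "0 \<le> s" "s < t" "t \<le> T" for s t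
  proof -
    have "\<bar>y t - y s\<bar> \<le> 2 * (\<bar>\<alpha>\<bar> * (K * (t - s)) + \<sigma> * N * (t - s) powr \<beta>)"
    proof (rule skorohod_path_oscillation[OF sk])
      fix u assume u: "s \<le> u" "u \<le> t"
      have "F u - F s \<le> K * (u - s)" using FK u st by simp
      also have "\<dots> \<le> K * (t - s)" using u K0 by (simp add: mult_left_mono)
      finally have "\<bar>\<alpha>\<bar> * (F u - F s) \<le> \<bar>\<alpha>\<bar> * (K * (t - s))" by (simp add: mult_left_mono)
      moreover have "\<sigma> * N * (u - s) powr \<beta> \<le> \<sigma> * N * (t - s) powr \<beta>"
        using u \<sigma> N \<beta> by (intro mult_left_mono powr_mono2) auto
      ultimately show "\<bar>(y u - l u) - (y s - l s)\<bar> \<le> \<bar>\<alpha>\<bar> * (K * (t - s)) + \<sigma> * N * (t - s) powr \<beta>"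
        using z[of s u] u st by simp
    qed (use st in auto)
    \<comment> \<open>The Lipschitz drift term is turned into a Hoelder term of order
      \<open>\<beta> \<le> 1\<close> on the bounded interval.\<close>
    moreover have "t - s \<le> T powr (1 - \<beta>) * (t - s) powr \<beta>"
    proof -
      have "t - s = (t - s) powr (1 - \<beta>) * (t - s) powr \<beta>" using st by (simp add: powr_add[symmetric])
      also have "\<dots> \<le> T powr (1 - \<beta>) * (t - s) powr \<beta>"
        using st \<beta> by (intro mult_right_mono powr_mono2) auto
      finally show ?thesis .
    qed
    then have "\<bar>\<alpha>\<bar> * (K * (t - s)) \<le> \<bar>\<alpha>\<bar> * (K * (T powr (1 - \<beta>) * (t - s) powr \<beta>))"
      using K0 by (intro mult_left_mono) auto
    ultimately show ?thesis by (simp add: algebra_simps)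
  qed
  show "\<bar>y t - y s\<bar> \<le> 2 * (\<bar>\<alpha>\<bar> * K * T powr (1 - \<beta>) + \<sigma> * N) * \<bar>t - s\<bar> powr \<beta>"
    if "s \<in> {0..T}" "t \<in> {0..T}" for s t
    using less[of s t] less[of t s] that by (cases s t rule: linorder_cases) (auto simp: abs_minus_commute)
qed

section \<open>Exponential moments for fractional Brownian motion\<close>

lemma gaussian_rv_square_integrable:
  assumes "gaussian_rv M Y"
  shows "integrable M Y" and "integrable M (\<lambda>\<omega>. (Y \<omega>)\<^sup>2)"
proof -
  from assms obtain \<mu> s where Y [measurable]: "Y \<in> borel_measurable M" and s: "0 \<le> s"
    and D: "distr M borel Y =
          (if s = 0 then return borel \<mu> else density lborel (normal_density \<mu> s))"
    unfolding gaussian_rv_def by blast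
  have "integrable (distr M borel Y) (\<lambda>x. x) \<and> integrable (distr M borel Y) (\<lambda>x. x\<^sup>2)"
  proof (cases "s = 0")
    case True
    interpret R: prob_space "return borel \<mu> :: real measure" by (rule prob_space_return) simp
    have int: "integrable (return borel \<mu>) f" if [measurable]: "f \<in> borel_measurable borel"
      for f :: "real \<Rightarrow> real"
    proof (rule integrable_cong_AE_imp[OF R.integrable_const[of "f \<mu>"]])
      show "AE x in return borel \<mu>. f \<mu> = f x" by (subst AE_return) simp_all
    qed simp
    have "distr M borel Y = return borel \<mu>" unfolding D by (rule if_P) (rule True)
    then show ?thesis by (simp only:) (intro conjI int; measurable)
  next
    case False
    then have s: "0 < s" using s by simp
    have i1: "integrable lborel (\<lambda>x. normal_density \<mu> s x * x)"
      by (rule integrable_normal_moment_nz_1[OF s])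
    \<comment> \<open>This is the expansion \<open>x\<^sup>2 = (x - \<mu>)\<^sup>2 + 2 * \<mu> * x -
      \<mu>\<^sup>2\<close> against the density.\<close>
    have "integrable lborel (\<lambda>x. normal_density \<mu> s x * (x - \<mu>) ^ 2 +
        2 * \<mu> * (normal_density \<mu> s x * x) - \<mu>\<^sup>2 * normal_density \<mu> s x)"
      by (intro Bochner_Integration.integrable_add Bochner_Integration.integrable_diff
          integrable_mult_right i1 integrable_normal_moment integrable_normal_density s)
    also have "(\<lambda>x. normal_density \<mu> s x * (x - \<mu>) ^ 2 +
        2 * \<mu> * (normal_density \<mu> s x * x) - \<mu>\<^sup>2 * normal_density \<mu> s x) =
        (\<lambda>x. normal_density \<mu> s x * x\<^sup>2)"
      by (rule ext) (simp add: power2_eq_square algebra_simps)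
    finally have i2: "integrable lborel (\<lambda>x. normal_density \<mu> s x * x\<^sup>2)" .
    have dens: "integrable (density lborel (normal_density \<mu> s)) f"
      if "integrable lborel (\<lambda>x. normal_density \<mu> s x * f x)" "f \<in> borel_measurable borel"
      for f :: "real \<Rightarrow> real"
      using that by (subst integrable_density) auto
    have
      "integrable (density lborel (normal_density \<mu> s)) (\<lambda>x. x) \<and>
       integrable (density lborel (normal_density \<mu> s)) (\<lambda>x. x\<^sup>2)"
      by (intro conjI dens[OF i1] dens[OF i2]) simp_all
    moreover have "distr M borel Y = density lborel (normal_density \<mu> s)"
      unfolding D by (rule if_not_P) (rule False)
    ultimately show ?thesis by (simp only:)
  qed
  note int = this
  show "integrable M Y" by (rule integrable_distr[OF Y conjunct1[OF int]])
  show "integrable M (\<lambda>\<omega>. (Y \<omega>)\<^sup>2)" by (rule integrable_distr[OF Y conjunct2[OF int]])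
qed

text \<open>The factor cancels half of the Gaussian exponent: the product is \<open>sqrt 2\<close>
  times the centred normal density with variance \<open>2 * s\<^sup>2\<close>.\<close>

lemma nn_integral_exp_square_normal:
  fixes s :: real
  assumes s: "0 < s"
  shows "(\<integral>\<^sup>+x. ennreal (normal_density 0 s x) * ennreal (exp (x\<^sup>2 / (4 * s\<^sup>2))) \<partial>lborel) = ennreal (sqrt 2)"
proof -
  have eq: "normal_density 0 s x * exp (x\<^sup>2 / (4 * s\<^sup>2)) = sqrt 2 * normal_density 0 (sqrt 2 * s) x" for x
  proof -
    have "exp (- (x\<^sup>2) / (2 * s\<^sup>2)) * exp (x\<^sup>2 / (4 * s\<^sup>2)) = exp (- (x\<^sup>2) / (4 * s\<^sup>2))"
      unfolding exp_add[symmetric] using s by (simp add: field_simps)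
    then show ?thesis using s
      by (simp add: normal_density_def power_mult_distrib real_sqrt_mult field_simps)
  qed
  interpret N: prob_space "density lborel (normal_density 0 (sqrt 2 * s))"
    by (rule prob_space_normal_density) (use s in simp)
  have one: "(\<integral>\<^sup>+x. ennreal (normal_density 0 (sqrt 2 * s) x) \<partial>lborel) = 1"
    using N.emeasure_space_1 by (simp add: emeasure_density)
  have "(\<integral>\<^sup>+x. ennreal (normal_density 0 s x) * ennreal (exp (x\<^sup>2 / (4 * s\<^sup>2))) \<partial>lborel) =
      (\<integral>\<^sup>+x. ennreal (sqrt 2) * ennreal (normal_density 0 (sqrt 2 * s) x) \<partial>lborel)"
    by (intro nn_integral_cong) (simp add: ennreal_mult[symmetric] eq)
  also have "\<dots> = ennreal (sqrt 2)" by (simp add: nn_integral_cmult one)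
  finally show ?thesis .
qed

lemma gaussian_rv_exp_square:
  assumes "prob_space M" and g: "gaussian_rv M Y" and mean: "(\<integral>\<omega>. Y \<omega> \<partial>M) = 0"
    and var: "(\<integral>\<omega>. (Y \<omega>)\<^sup>2 \<partial>M) = v" and v: "0 < v"
  shows "(\<integral>\<^sup>+\<omega>. ennreal (exp ((Y \<omega>)\<^sup>2 / (4 * v))) \<partial>M) = ennreal (sqrt 2)"
proof -
  interpret prob_space M by fact
  from g obtain \<mu> s where Y [measurable]: "Y \<in> borel_measurable M" and s: "0 \<le> s"
    and D: "distr M borel Y =
          (if s = 0 then return borel \<mu> else density lborel (normal_density \<mu> s))"
    unfolding gaussian_rv_def by blast
  \<comment> \<open>A point mass with mean 0 sits at 0 and has second moment 0, contradicting
    \<open>v > 0\<close>.\<close>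
  have "s \<noteq> 0"
  proof
    assume "s = 0"
    then have "distr M borel Y = return borel \<mu>" unfolding D by (rule if_P)
    then have "AE x in distr M borel Y. x = \<mu>" by (simp only:) (subst AE_return, auto)
    then have Y\<mu>: "AE \<omega> in M. Y \<omega> = \<mu>" by (subst (asm) AE_distr_iff) auto
    then have "expectation Y = expectation (\<lambda>_. \<mu>)" by (intro integral_cong_AE) auto
    then have "\<mu> = 0" using mean by (simp add: prob_space)
    then have "expectation (\<lambda>\<omega>. (Y \<omega>)\<^sup>2) = expectation (\<lambda>_. 0)"
      using Y\<mu> by (intro integral_cong_AE) auto
    then show False using var v by simp
  qed
  then have s: "0 < s" and D: "distributed M lborel Y (normal_density \<mu> s)"
    using s D by (auto simp: distributed_def cong: distr_cong)
  have \<mu>: "\<mu> = 0" using normal_distributed_expectation[OF s D] mean by simp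
  have v_eq: "v = s\<^sup>2" using normal_distributed_variance[OF s D] mean var by simp
  have "(\<integral>\<^sup>+\<omega>. ennreal (exp ((Y \<omega>)\<^sup>2 / (4 * v))) \<partial>M) =
      (\<integral>\<^sup>+x. ennreal (normal_density 0 s x) * ennreal (exp (x\<^sup>2 / (4 * s\<^sup>2))) \<partial>lborel)"
    unfolding v_eq using D unfolding \<mu>
    by (intro distributed_nn_integral[symmetric, where g = "\<lambda>x. ennreal (exp (x\<^sup>2 / (4 * s\<^sup>2)))"]) auto
  then show ?thesis using nn_integral_exp_square_normal[OF s] by simp
qed

text \<open>The increment is a linear combination with coefficients 1 and -1, hence Gaussian and
  centred; the covariance formula gives it variance \<open>(t - s) powr (2 * H)\<close>, which is
  positive.\<close>

lemma fbm_increment_exp_square: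
  assumes fbm: "fractional_brownian_motion H M W" and st: "0 \<le> s" "s < t"
  shows "(\<integral>\<^sup>+\<omega>. ennreal (exp ((W t \<omega> - W s \<omega>)\<^sup>2 / (4 * (t - s) powr (2 * H)))) \<partial>M) = ennreal (sqrt 2)"
proof -
  have ps: "prob_space M" and gp: "gaussian_process M {0..} W"
    and mean: "\<And>t. 0 \<le> t \<Longrightarrow> (\<integral>\<omega>. W t \<omega> \<partial>M) = 0"
    and cov: "\<And>s t. 0 \<le> s \<Longrightarrow> 0 \<le> t \<Longrightarrow> covariance M (W s) (W t) =
        (t powr (2 * H) + s powr (2 * H) - \<bar>t - s\<bar> powr (2 * H)) / 2"
    using fbm unfolding fractional_brownian_motion_def by blast+
  interpret prob_space M by (fact ps)
  have lin: "gaussian_rv M (\<lambda>\<omega>. \<Sum>i\<in>J. c i * W i \<omega>)" if "finite J" "J \<subseteq> {0..}" for J c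
    using gp that unfolding gaussian_process_def by blast
  have t: "0 \<le> t" using st by simp
  have gW: "gaussian_rv M (W r)" if "0 \<le> r" for r
    using lin[of "{r}" "\<lambda>_. 1"] that by simp
  have "gaussian_rv M (\<lambda>\<omega>. \<Sum>i\<in>{s, t}. (if i = t then 1 else - 1) * W i \<omega>)"
    by (rule lin) (use st in auto)
  moreover have "(\<Sum>i\<in>{s, t}. (if i = t then 1 else - 1) * W i \<omega>) = W t \<omega> - W s \<omega>" for \<omega>
    using st by simp
  ultimately have g: "gaussian_rv M (\<lambda>\<omega>. W t \<omega> - W s \<omega>)" by simp
  \<comment> \<open>The Bochner integral of a non-integrable function is 0, so the expectation of
    the squared increment may be expanded only once every term is known to be integrable.\<close>
  note [simp] = gaussian_rv_square_integrable[OF gW[OF t]] gaussian_rv_square_integrable[OF gW[OF st(1)]]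
  \<comment> \<open>Polarization: the increment is itself Gaussian, so its square is integrable and
    the mixed product can be solved for.\<close>
  have [simp]: "integrable M (\<lambda>\<omega>. W s \<omega> * W t \<omega>)"
  proof -
    have "integrable M (\<lambda>\<omega>. ((W s \<omega>)\<^sup>2 + (W t \<omega>)\<^sup>2 - (W t \<omega> - W s \<omega>)\<^sup>2) / 2)"
      using gaussian_rv_square_integrable[OF g] by simp
    also have "(\<lambda>\<omega>. ((W s \<omega>)\<^sup>2 + (W t \<omega>)\<^sup>2 - (W t \<omega> - W s \<omega>)\<^sup>2) / 2) = (\<lambda>\<omega>. W s \<omega> * W t \<omega>)"
      by (rule ext) (simp add: power2_eq_square field_simps)
    finally show ?thesis .
  qed
  have cov': "expectation (\<lambda>\<omega>. W r \<omega> * W u \<omega>) =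
      (u powr (2 * H) + r powr (2 * H) - \<bar>u - r\<bar> powr (2 * H)) / 2" if "0 \<le> r" "0 \<le> u" for r u
    using cov[OF that] mean that by (simp add: covariance_def)
  have "expectation (\<lambda>\<omega>. (W t \<omega> - W s \<omega>)\<^sup>2) =
      expectation (\<lambda>\<omega>. (W t \<omega>)\<^sup>2 + (W s \<omega>)\<^sup>2 - 2 * (W s \<omega> * W t \<omega>))"
    by (rule Bochner_Integration.integral_cong) (auto simp: power2_eq_square algebra_simps)
  also have "\<dots> = expectation (\<lambda>\<omega>. (W t \<omega>)\<^sup>2) + expectation (\<lambda>\<omega>. (W s \<omega>)\<^sup>2)
      - 2 * expectation (\<lambda>\<omega>. W s \<omega> * W t \<omega>)"
    by simp
  \<comment> \<open>On the diagonal the covariance is \<open>t powr (2 * H)\<close>, because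
    \<open>0 powr (2 * H) = 0\<close>.\<close>
  also have "\<dots> = (t - s) powr (2 * H)"
    using cov'[OF t t] cov'[OF st(1) st(1)] cov'[OF st(1) t] st by (simp add: power2_eq_square)
  finally have var: "expectation (\<lambda>\<omega>. (W t \<omega> - W s \<omega>)\<^sup>2) = (t - s) powr (2 * H)" .
  have "expectation (\<lambda>\<omega>. W t \<omega> - W s \<omega>) = 0" using mean st by simp
  from gaussian_rv_exp_square[OF ps g this var] st show ?thesis by simp
qed

section \<open>The weighted sum over dyadic increments and the Hoelder constant of the driving
  path\<close>

lemma fbm_borel_measurable:
  assumes "fractional_brownian_motion H M W" and "0 \<le> t"
  shows "W t \<in> borel_measurable M"
proof -
  have "gaussian_process M {0..} W"
    using assms(1) unfolding fractional_brownian_motion_def by blast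
  then have "gaussian_rv M (\<lambda>\<omega>. \<Sum>i\<in>J. c i * W i \<omega>)" if "finite J" "J \<subseteq> {0..}" for J c
    using that unfolding gaussian_process_def by blast
  from this[of "{t}" "\<lambda>_. 1"] show ?thesis using assms(2) by (simp add: gaussian_rv_def)
qed

text \<open>The summability weight \<open>exp (- n)\<close> beats the \<open>2 ^ n\<close> increments of level \<open>n\<close>; the price is
  the summand \<open>n\<close> in the bound for a single increment, which is absorbed in the gap between
  \<open>\<beta>\<close> and \<open>H\<close>.\<close>

definition dyadic_exp_sum ::
    "real \<Rightarrow> real \<Rightarrow> (real \<Rightarrow> 'a \<Rightarrow> real) \<Rightarrow> 'a \<Rightarrow> ennreal" where
  "dyadic_exp_sum H T W \<omega> = (\<Sum>n. \<Sum>k<2 ^ n. ennreal (exp (- real n)) *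
     ennreal (exp ((W (T * real (Suc k) / 2 ^ n) \<omega> - W (T * real k / 2 ^ n) \<omega>)\<^sup>2 /
       (4 * (T / 2 ^ n) powr (2 * H)))))"

lemma borel_measurable_dyadic_exp_sum:
  assumes "fractional_brownian_motion H M W" and "0 < T"
  shows "dyadic_exp_sum H T W \<in> borel_measurable M"
proof -
  have [measurable]: "W (T * real k / 2 ^ n) \<in> borel_measurable M" for k n :: nat
    by (rule fbm_borel_measurable[OF assms(1)]) (use assms in simp)
  show ?thesis unfolding dyadic_exp_sum_def by measurable
qed

text \<open>Level \<open>n\<close> contributes \<open>2 ^ n\<close> terms of expectation
  \<open>exp (- n) * sqrt 2\<close>, which is a geometric series.\<close>

lemma nn_integral_dyadic_exp_sum:
  assumes fbm: "fractional_brownian_motion H M W" and T: "0 < T"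
  shows "(\<integral>\<^sup>+\<omega>. dyadic_exp_sum H T W \<omega> \<partial>M) < \<infinity>"
proof -
  have [measurable]: "W (T * real k / 2 ^ n) \<in> borel_measurable M" for k n :: nat
    by (rule fbm_borel_measurable[OF fbm]) (use T in simp)
  have inc: "(\<integral>\<^sup>+\<omega>. ennreal (exp ((W (T * real (Suc k) / 2 ^ n) \<omega> - W (T * real k / 2 ^ n) \<omega>)\<^sup>2 /
       (4 * (T / 2 ^ n) powr (2 * H)))) \<partial>M) = ennreal (sqrt 2)" for n k :: nat
  proof -
    have "T * real (Suc k) / 2 ^ n - T * real k / 2 ^ n = T / 2 ^ n"
      by (simp add: diff_divide_distrib[symmetric] algebra_simps)
    then show ?thesis
      using fbm_increment_exp_square[OF fbm, of "T * real k / 2 ^ n" "T * real (Suc k) / 2 ^ n"] T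
      by (simp add: divide_strict_right_mono)
  qed
  have term_int: "(\<integral>\<^sup>+\<omega>. ennreal (exp (- real n)) *
     ennreal (exp ((W (T * real (Suc k) / 2 ^ n) \<omega> - W (T * real k / 2 ^ n) \<omega>)\<^sup>2 /
       (4 * (T / 2 ^ n) powr (2 * H)))) \<partial>M) = ennreal (exp (- real n)) * ennreal (sqrt 2)" for n k :: nat
    by (subst nn_integral_cmult, measurable) (simp only: inc)
  have "(\<integral>\<^sup>+\<omega>. dyadic_exp_sum H T W \<omega> \<partial>M) =
      (\<Sum>n. \<Sum>k<(2::nat) ^ n. ennreal (exp (- real n)) * ennreal (sqrt 2))"
    unfolding dyadic_exp_sum_def
    by (subst nn_integral_suminf, measurable, subst nn_integral_sum, measurable) (simp only: term_int)
  also have "\<dots> = (\<Sum>n. ennreal (sqrt 2 * (2 * exp (- 1)) ^ n))"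
    by (simp add: ennreal_mult[symmetric] power_mult_distrib exp_of_nat_mult[symmetric]
        ennreal_of_nat_eq_real_of_nat ac_simps)
  also have "\<dots> = ennreal (\<Sum>n. sqrt 2 * (2 * exp (- 1)) ^ n)"
  proof (rule suminf_ennreal2)
    \<comment> \<open>The ratio \<open>2 * exp (- 1)\<close> is below 1 since
      \<open>exp 1 \<ge> (1 + 1/2) ^ 2 = 9/4\<close>.\<close>
    have "2 < exp (1::real)" using exp_ge_one_plus_x_over_n_power_n[of 2 1] by (simp add: power2_eq_square)
    then have "2 * exp (- 1) < (1::real)" by (simp add: exp_minus field_simps)
    then show "summable (\<lambda>n. sqrt 2 * (2 * exp (- 1)) ^ n :: real)"
      by (intro summable_mult summable_geometric) simp
  qed simp
  finally show ?thesis by simp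
qed

text \<open>The surplus exponent \<open>2 * \<epsilon>\<close> absorbs the linear growth in
  \<open>n\<close>, uniformly over all levels. It rests on \<open>exp z \<ge> z\<close> at
  \<open>z = 2 * \<epsilon> * n * ln 2\<close>, with \<open>ln 2 \<ge> 1/2\<close>.\<close>

lemma level_weight_le:
  fixes \<epsilon> :: real
  assumes "0 < \<epsilon>"
  shows "real n * (1 / 2 ^ n) powr (2 * \<epsilon>) \<le> 1 / \<epsilon>"
proof -
  define P where "P = 2 powr (real n * (2 * \<epsilon>))"
  have "1 / 2 \<le> ln (2::real)" using ln2_ge_two_thirds by simp
  then have "real n * (2 * \<epsilon>) * (1 / 2) \<le> real n * (2 * \<epsilon>) * ln 2"
    using assms by (intro mult_left_mono) auto
  also have "\<dots> \<le> exp (real n * (2 * \<epsilon>) * ln 2)"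
    using exp_ge_add_one_self[of "real n * (2 * \<epsilon>) * ln 2"] by linarith
  finally have "real n * \<epsilon> \<le> P" by (simp add: P_def powr_def)
  moreover have "0 < P" by (simp add: P_def)
  ultimately have "real n / P \<le> 1 / \<epsilon>" using assms by (simp add: field_simps)
  moreover have "(1 / 2 ^ n) powr (2 * \<epsilon>) = 1 / P"
    by (simp add: P_def powr_divide powr_realpow[symmetric] powr_powr)
  ultimately show ?thesis by simp
qed

text \<open>Each summand is at most the whole sum \<open>S\<close>, so taking logarithms bounds
  every squared dyadic increment of mesh \<open>h\<close> by
  \<open>4 * h powr (2 * H) * (n + ln (1 + S))\<close>. Giving up
  \<open>h powr (2 * (H - \<beta>))\<close> removes \<open>n\<close>, and chaining extends the bound
  to all times.\<close>

lemma fbm_hoelder_bound: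
  fixes H \<beta> T :: real
  assumes \<beta>: "0 < \<beta>" "\<beta> < H" and T: "0 < T"
    and cont: "continuous_on {0..} (\<lambda>t. W t \<omega>)"
    and fin: "dyadic_exp_sum H T W \<omega> < \<infinity>"
    and st: "s \<in> {0..T}" "t \<in> {0..T}"
  shows "\<bar>W t \<omega> - W s \<omega>\<bar> \<le> chaining_const \<beta> *
    sqrt (4 * T powr (2 * (H - \<beta>)) * (1 / (H - \<beta>) + ln (1 + enn2real (dyadic_exp_sum H T W \<omega>)))) *
    \<bar>t - s\<bar> powr \<beta>"
proof (rule dyadic_chaining[where w = "\<lambda>t. W t \<omega>"])
  define S where "S = enn2real (dyadic_exp_sum H T W \<omega>)"
  define \<epsilon> where "\<epsilon> = H - \<beta>"
  have \<epsilon>: "0 < \<epsilon>" using \<beta> by (simp add: \<epsilon>_def)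
  have S0: "0 \<le> S" by (simp add: S_def)
  \<comment> \<open>Finiteness is essential: \<open>enn2real\<close> would send an infinite sum to
    0.\<close>
  have S: "dyadic_exp_sum H T W \<omega> = ennreal S" using fin by (simp add: S_def less_top)
  show "continuous_on {0..T} (\<lambda>t. W t \<omega>)" by (rule continuous_on_subset[OF cont]) auto
  show "0 \<le> sqrt (4 * T powr (2 * (H - \<beta>)) * (1 / (H - \<beta>) + ln (1 + enn2real (dyadic_exp_sum H T W \<omega>))))"
    using \<beta> S0 by (simp add: S_def)
  fix n k :: nat assume k: "k < 2 ^ n"
  define h where "h = T / 2 ^ n"
  define D where "D = W (T * real (Suc k) / 2 ^ n) \<omega> - W (T * real k / 2 ^ n) \<omega>"
  have h: "0 < h" using T by (simp add: h_def)
  have "ennreal (exp (- real n)) * ennreal (exp (D\<^sup>2 / (4 * h powr (2 * H)))) \<le>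
     (\<Sum>k<2 ^ n. ennreal (exp (- real n)) *
     ennreal (exp ((W (T * real (Suc k) / 2 ^ n) \<omega> - W (T * real k / 2 ^ n) \<omega>)\<^sup>2 /
       (4 * (T / 2 ^ n) powr (2 * H)))))"
    unfolding D_def h_def using k
    by (intro member_le_sum[where f = "\<lambda>k. ennreal (exp (- real n)) *
     ennreal (exp ((W (T * real (Suc k) / 2 ^ n) \<omega> - W (T * real k / 2 ^ n) \<omega>)\<^sup>2 /
       (4 * (T / 2 ^ n) powr (2 * H))))"]) auto
  also have "\<dots> \<le> dyadic_exp_sum H T W \<omega>"
    unfolding dyadic_exp_sum_def
    using sum_le_suminf[OF summableI, of "{n}" "\<lambda>n. \<Sum>k<2 ^ n. ennreal (exp (- real n)) *
     ennreal (exp ((W (T * real (Suc k) / 2 ^ n) \<omega> - W (T * real k / 2 ^ n) \<omega>)\<^sup>2 /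
       (4 * (T / 2 ^ n) powr (2 * H))))"] by simp
  finally have "exp (D\<^sup>2 / (4 * h powr (2 * H)) - real n) \<le> S"
    unfolding S using S0 by (simp add: ennreal_mult[symmetric] exp_add[symmetric])
  \<comment> \<open>Passing from \<open>S\<close> to \<open>1 + S\<close> makes the logarithm
    non-negative, as the later monotonicity steps require.\<close>
  then have "exp (D\<^sup>2 / (4 * h powr (2 * H)) - real n) \<le> 1 + S" by simp
  then have "D\<^sup>2 / (4 * h powr (2 * H)) - real n \<le> ln (1 + S)"
    using S0 by (subst ln_ge_iff) auto
  then have "D\<^sup>2 \<le> 4 * h powr (2 * H) * (real n + ln (1 + S))"
    using h by (simp add: field_simps)
  also have "h powr (2 * H) = h powr (2 * \<epsilon>) * h powr (2 * \<beta>)"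
    by (simp add: powr_add[symmetric] \<epsilon>_def algebra_simps)
  also have "4 * (h powr (2 * \<epsilon>) * h powr (2 * \<beta>)) * (real n + ln (1 + S)) =
      (4 * (h powr (2 * \<epsilon>) * (real n + ln (1 + S)))) * h powr (2 * \<beta>)"
    by simp
  also have "\<dots> \<le> (4 * (T powr (2 * \<epsilon>) * (1 / \<epsilon> + ln (1 + S)))) * h powr (2 * \<beta>)"
  proof (intro mult_right_mono mult_left_mono)
    have "h powr (2 * \<epsilon>) = T powr (2 * \<epsilon>) * (1 / 2 ^ n) powr (2 * \<epsilon>)"
      using T by (simp add: h_def powr_divide)
    then have "h powr (2 * \<epsilon>) * (real n + ln (1 + S)) =
        T powr (2 * \<epsilon>) * (real n * (1 / 2 ^ n) powr (2 * \<epsilon>) + (1 / 2 ^ n) powr (2 * \<epsilon>) * ln (1 + S))"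
      by (simp add: algebra_simps)
    also have "\<dots> \<le> T powr (2 * \<epsilon>) * (1 / \<epsilon> + ln (1 + S))"
    proof (intro mult_left_mono add_mono level_weight_le \<epsilon>)
      have "(1 / 2 ^ n) powr (2 * \<epsilon>) \<le> (1 :: real)" using \<epsilon> by (intro powr_le1) auto
      then show "(1 / 2 ^ n) powr (2 * \<epsilon>) * ln (1 + S) \<le> ln (1 + S)"
        using S0 by (intro mult_left_le_one_le) auto
    qed simp
    finally show "h powr (2 * \<epsilon>) * (real n + ln (1 + S)) \<le> T powr (2 * \<epsilon>) * (1 / \<epsilon> + ln (1 + S))" .
  qed auto
  finally have "sqrt (D\<^sup>2) \<le> sqrt ((4 * (T powr (2 * \<epsilon>) * (1 / \<epsilon> + ln (1 + S)))) * h powr (2 * \<beta>))"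
    by (rule real_sqrt_le_mono)
  moreover have "sqrt (h powr (2 * \<beta>)) = h powr \<beta>"
    using h by (simp add: powr_half_sqrt[symmetric] powr_powr)
  ultimately show "\<bar>W (T * real (Suc k) / 2 ^ n) \<omega> - W (T * real k / 2 ^ n) \<omega>\<bar> \<le>
    sqrt (4 * T powr (2 * (H - \<beta>)) * (1 / (H - \<beta>) + ln (1 + enn2real (dyadic_exp_sum H T W \<omega>)))) *
    (T / 2 ^ n) powr \<beta>"
    by (simp add: real_sqrt_mult D_def h_def \<epsilon>_def S_def mult.assoc)
qed (use \<beta> T st in auto)

section \<open>Expectations of path functionals\<close>

text \<open>Changing a function on a null set changes its preimages by subsets of null sets, which
  the completion contains.\<close>

lemma borel_measurable_completion_cong_AE:
  assumes g: "g \<in> borel_measurable (completion M)" and ae: "AE \<omega> in M. f \<omega> = g \<omega>"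
  shows "f \<in> borel_measurable (completion M)"
proof (rule measurableI)
  fix A :: "'b set" assume A: "A \<in> sets borel"
  show "f -` A \<inter> space (completion M) \<in> sets (completion M)"
  proof (rule completion.in_sets_AE)
    show "g -` A \<inter> space (completion M) \<in> sets (completion M)"
      using measurable_sets[OF g A] .
    show "AE \<omega> in completion M.
        \<omega> \<in> g -` A \<inter> space (completion M) \<longleftrightarrow> \<omega> \<in> f -` A \<inter> space (completion M)"
      using AE_completion[OF ae] by eventually_elim simp
  qed simp
qed simp

lemma borel_measurable_exp_ennreal [measurable]: "exp_ennreal \<in> borel_measurable borel"
  unfolding exp_ennreal_def[abs_def] by measurable

lemma exp_ennreal_le:
  assumes "a \<le> ennreal r" "0 \<le> r"
  shows "exp_ennreal a \<le> ennreal (exp r)"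
proof -
  have "a < \<infinity>" using le_less_trans[OF assms(1) ennreal_less_top] by simp
  moreover have "enn2real a \<le> r" using enn2real_mono[OF assms(1)] assms(2) by simp
  ultimately show ?thesis by (auto simp: exp_ennreal_def intro!: ennreal_leI)
qed

lemma SUP_continuous_dense:
  fixes F :: "'b::metric_space \<Rightarrow> real"
  assumes F: "continuous_on S F" and D: "D \<subseteq> S" "S \<subseteq> closure D"
  shows "(SUP p\<in>S. ennreal (F p)) = (SUP p\<in>D. ennreal (F p))"
proof (rule antisym)
  show "(SUP p\<in>S. ennreal (F p)) \<le> (SUP p\<in>D. ennreal (F p))"
  proof (rule SUP_least)
    fix p assume p: "p \<in> S"
    then have "p \<in> closure D" using D(2) by blast
    then obtain f where f: "\<And>n. f n \<in> D" "f \<longlonglongrightarrow> p"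
      unfolding closure_sequential by blast
    have "(\<lambda>n. F (f n)) \<longlonglongrightarrow> F p"
      using F p f D(1) unfolding continuous_on_sequentially by (auto simp: o_def subset_iff)
    then have "(\<lambda>n. ennreal (F (f n))) \<longlonglongrightarrow> ennreal (F p)"
      by (rule tendsto_ennrealI)
    then show "ennreal (F p) \<le> (SUP p\<in>D. ennreal (F p))"
      by (rule LIMSEQ_le_const2) (use f in \<open>auto intro!: exI[of _ 0] SUP_upper\<close>)
  qed
  show "(SUP p\<in>D. ennreal (F p)) \<le> (SUP p\<in>S. ennreal (F p))"
    by (rule SUP_subset_mono[OF D(1)]) simp
qed

text \<open>Both path norms are suprema of functionals continuous in a parameter \<open>p\<close>,
  so one argument serves for both. The bound gives \<open>\<kappa>\<close> times the squared
  supremum at most \<open>a + ln (1 + Z)\<close>, whose exponential is integrable with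
  \<open>Z\<close>.\<close>

lemma finite_expectation_exp_square_SUP:
  fixes G :: "'a \<Rightarrow> 'b::{metric_space, second_countable_topology} \<Rightarrow> real" and Z :: "'a \<Rightarrow> ennreal"
  assumes M: "prob_space M" and \<kappa>: "0 < \<kappa>" and a: "0 \<le> a"
    and meas: "\<And>p. p \<in> S \<Longrightarrow> (\<lambda>\<omega>. G \<omega> p) \<in> borel_measurable (completion M)"
    and cont: "AE \<omega> in M. continuous_on S (G \<omega>)"
    and Z [measurable]: "Z \<in> borel_measurable M" and Z_fin: "(\<integral>\<^sup>+\<omega>. Z \<omega> \<partial>M) < \<infinity>"
    and bound: "AE \<omega> in M. \<forall>p\<in>S. 0 \<le> G \<omega> p \<and> (G \<omega> p)\<^sup>2 \<le> (a + ln (1 + enn2real (Z \<omega>))) / \<kappa>"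
  shows "finite_expectation M (\<lambda>\<omega>. exp_ennreal (ennreal \<kappa> * (SUP p\<in>S. ennreal (G \<omega> p))\<^sup>2))"
  unfolding finite_expectation_def
proof
  interpret prob_space M by fact
  \<comment> \<open>An uncountable supremum need not be measurable. By continuity it almost surely
    equals the supremum over the countable dense set \<open>D\<close>, and the completion absorbs
    the exceptional null set.\<close>
  obtain D where D: "countable D" "D \<subseteq> S" "S \<subseteq> closure D" by (rule separable)
  show "(\<lambda>\<omega>. exp_ennreal (ennreal \<kappa> * (SUP p\<in>S. ennreal (G \<omega> p))\<^sup>2)) \<in> borel_measurable (completion M)"
  proof (rule borel_measurable_completion_cong_AE)
    have [measurable]: "(\<lambda>\<omega>. SUP p\<in>D. ennreal (G \<omega> p)) \<in> borel_measurable (completion M)"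
      by (rule borel_measurable_SUP) (use D meas in \<open>auto intro!: measurable_compose[OF _ measurable_ennreal]\<close>)
    show "(\<lambda>\<omega>. exp_ennreal (ennreal \<kappa> * (SUP p\<in>D. ennreal (G \<omega> p))\<^sup>2)) \<in> borel_measurable (completion M)"
      by measurable
    show "AE \<omega> in M. exp_ennreal (ennreal \<kappa> * (SUP p\<in>S. ennreal (G \<omega> p))\<^sup>2) =
        exp_ennreal (ennreal \<kappa> * (SUP p\<in>D. ennreal (G \<omega> p))\<^sup>2)"
      using cont by eventually_elim (simp add: SUP_continuous_dense[OF _ D(2,3)])
  qed
  have "(\<integral>\<^sup>+\<omega>. exp_ennreal (ennreal \<kappa> * (SUP p\<in>S. ennreal (G \<omega> p))\<^sup>2) \<partial>completion M) \<le>
      (\<integral>\<^sup>+\<omega>. ennreal (exp a) * (1 + Z \<omega>) \<partial>completion M)"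
  proof (rule nn_integral_mono_AE, rule AE_completion)
    show "AE \<omega> in M. exp_ennreal (ennreal \<kappa> * (SUP p\<in>S. ennreal (G \<omega> p))\<^sup>2) \<le> ennreal (exp a) * (1 + Z \<omega>)"
      using bound
    proof eventually_elim
      case (elim \<omega>)
      define r where "r = a + ln (1 + enn2real (Z \<omega>))"
      have r: "0 \<le> r" using a by (simp add: r_def)
      have "G \<omega> p \<le> sqrt (r / \<kappa>)" if "p \<in> S" for p
        using elim that by (intro real_le_rsqrt) (auto simp: r_def)
      then have "(SUP p\<in>S. ennreal (G \<omega> p)) \<le> ennreal (sqrt (r / \<kappa>))"
        by (intro SUP_least ennreal_leI) auto
      then have "(SUP p\<in>S. ennreal (G \<omega> p))\<^sup>2 \<le> (ennreal (sqrt (r / \<kappa>)))\<^sup>2"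
        by (rule power_mono) simp
      also have "\<dots> = ennreal (r / \<kappa>)" using r \<kappa> by (simp add: ennreal_power)
      finally have "ennreal \<kappa> * (SUP p\<in>S. ennreal (G \<omega> p))\<^sup>2 \<le> ennreal \<kappa> * ennreal (r / \<kappa>)"
        by (rule mult_left_mono) simp
      also have "\<dots> = ennreal r" using r \<kappa> by (simp add: ennreal_mult[symmetric])
      finally have "exp_ennreal (ennreal \<kappa> * (SUP p\<in>S. ennreal (G \<omega> p))\<^sup>2) \<le> ennreal (exp r)"
        using r by (rule exp_ennreal_le)
      also have "exp r = exp a * (1 + enn2real (Z \<omega>))"
        by (simp add: r_def exp_add add_pos_nonneg)
      also have "ennreal (exp a * (1 + enn2real (Z \<omega>))) = ennreal (exp a) * (1 + ennreal (enn2real (Z \<omega>)))"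
        by (simp add: ennreal_mult ennreal_plus flip: ennreal_1)
      \<comment> \<open>For infinite \<open>Z \<omega>\<close> the left side uses
        \<open>enn2real \<infinity> = 0\<close>, so the inequality also holds there.\<close>
      also have "\<dots> \<le> ennreal (exp a) * (1 + Z \<omega>)"
        by (intro mult_left_mono add_left_mono) (cases "Z \<omega>"; simp)+
      finally show ?case .
    qed
  qed
  also have "\<dots> = ennreal (exp a) * (1 + (\<integral>\<^sup>+\<omega>. Z \<omega> \<partial>M))"
    by (simp add: nn_integral_completion nn_integral_cmult nn_integral_add emeasure_space_1)
  also have "\<dots> < \<infinity>" using Z_fin by (simp add: ennreal_mult_less_top)
  finally show "(\<integral>\<^sup>+\<omega>. exp_ennreal (ennreal \<kappa> * (SUP p\<in>S. ennreal (G \<omega> p))\<^sup>2) \<partial>completion M) < \<infinity>" .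
qed

section \<open>Norms of the strong solution\<close>

lemma hoelder_imp_continuous_on:
  fixes y :: "real \<Rightarrow> real"
  assumes "0 < \<beta>" and y: "\<And>s t. s \<in> S \<Longrightarrow> t \<in> S \<Longrightarrow> \<bar>y t - y s\<bar> \<le> C * \<bar>t - s\<bar> powr \<beta>"
  shows "continuous_on S y"
  unfolding continuous_on_def
proof
  fix s assume s: "s \<in> S"
  have "((\<lambda>t. \<bar>t - s\<bar>) \<longlongrightarrow> \<bar>s - s\<bar>) (at s within S)" by (intro tendsto_intros)
  then have "((\<lambda>t. \<bar>t - s\<bar> powr \<beta>) \<longlongrightarrow> 0) (at s within S)"
    using assms(1) by (intro tendsto_zero_powrI[where b = \<beta>]) auto
  then have "((\<lambda>t. C * \<bar>t - s\<bar> powr \<beta>) \<longlongrightarrow> 0) (at s within S)"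
    by (rule tendsto_mult_right_zero)
  then have "((\<lambda>t. y t - y s) \<longlongrightarrow> 0) (at s within S)"
    by (rule Lim_null_comparison[rotated]) (use y s in \<open>auto simp: eventually_at_filter\<close>)
  then show "(y \<longlongrightarrow> y s) (at s within S)" by (simp add: LIM_zero_iff)
qed

text \<open>The constants are fixed before the path, so what they determine is the same for every
  probability space and every solution. Both path bounds are affine in \<open>N\<close>; adding
  their coefficients gives one pair for both.\<close>

lemma skorohod_path_bounds_linear:
  fixes \<alpha> \<sigma> x T \<beta> :: real
  assumes T: "0 < T" and \<beta>: "0 < \<beta>" "\<beta> \<le> 1" and \<sigma>: "0 < \<sigma>" and x: "0 \<le> x"
  obtains c d where "0 \<le> c" "0 < d"
    "\<And>w y l N. skorohod_path \<alpha> \<sigma> x w y l \<Longrightarrow> 0 \<le> N \<Longrightarrow>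
      (\<And>s t. s \<in> {0..T} \<Longrightarrow> t \<in> {0..T} \<Longrightarrow> \<bar>w t - w s\<bar> \<le> N * \<bar>t - s\<bar> powr \<beta>) \<Longrightarrow>
      (\<forall>t\<in>{0..T}. \<bar>y t\<bar> \<le> c + d * N) \<and>
      (\<forall>s\<in>{0..T}. \<forall>t\<in>{0..T}. \<bar>y t - y s\<bar> \<le> (c + d * N) * \<bar>t - s\<bar> powr \<beta>)"
proof -
  define e where "e = exp ((4 * \<bar>\<alpha>\<bar> + 1) * T)"
  define c1 where "c1 = 2 * x * e"
  define d1 where "d1 = 4 * \<sigma> * T powr \<beta> * e"
  define c2 where "c2 = 2 * \<bar>\<alpha>\<bar> * T powr (1 - \<beta>) * c1"
  define d2 where "d2 = 2 * \<bar>\<alpha>\<bar> * T powr (1 - \<beta>) * d1 + 2 * \<sigma>"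
  have e: "0 < e" by (simp add: e_def)
  have pos: "0 \<le> c1" "0 \<le> d1" "0 \<le> c2" "0 < d2"
    using e x \<sigma> by (auto simp: c1_def d1_def c2_def d2_def intro!: add_nonneg_pos)
  show ?thesis
  proof (rule that[of "c1 + c2" "d1 + d2"])
    fix w y l N
    assume sk: "skorohod_path \<alpha> \<sigma> x w y l" and N: "0 \<le> N"
      and w: "\<And>s t. s \<in> {0..T} \<Longrightarrow> t \<in> {0..T} \<Longrightarrow> \<bar>w t - w s\<bar> \<le> N * \<bar>t - s\<bar> powr \<beta>"
    have K: "2 * (x + 2 * \<sigma> * N * T powr \<beta>) * exp ((4 * \<bar>\<alpha>\<bar> + 1) * T) = c1 + d1 * N"
      unfolding c1_def d1_def e_def by (simp only: algebra_simps)
    have K': "2 * (\<bar>\<alpha>\<bar> * (c1 + d1 * N) * T powr (1 - \<beta>) + \<sigma> * N) = c2 + d2 * N"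
      unfolding c2_def d2_def by (simp only: algebra_simps)
    have dN: "0 \<le> d1 * N" "0 \<le> d2 * N" using pos N by auto
    have b1: "\<bar>y t\<bar> \<le> c1 + d1 * N" if "t \<in> {0..T}" for t
      by (rule skorohod_path_bounds(1)[OF sk T \<beta> N \<sigma> x, unfolded K, OF w that])
    have b2: "\<bar>y t - y s\<bar> \<le> (c2 + d2 * N) * \<bar>t - s\<bar> powr \<beta>" if "s \<in> {0..T}" "t \<in> {0..T}" for s t
      by (rule skorohod_path_bounds(2)[OF sk T \<beta> N \<sigma> x, unfolded K K', OF w that])
    show "(\<forall>t\<in>{0..T}. \<bar>y t\<bar> \<le> c1 + c2 + (d1 + d2) * N) \<and>
      (\<forall>s\<in>{0..T}. \<forall>t\<in>{0..T}. \<bar>y t - y s\<bar> \<le> (c1 + c2 + (d1 + d2) * N) * \<bar>t - s\<bar> powr \<beta>)"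
    proof (intro conjI ballI)
      fix t assume t: "t \<in> {0..T}"
      show "\<bar>y t\<bar> \<le> c1 + c2 + (d1 + d2) * N"
        using b1[OF t] pos dN by (simp add: distrib_right)
      fix s assume s: "s \<in> {0..T}"
      have "(c2 + d2 * N) * \<bar>s - t\<bar> powr \<beta> \<le> (c1 + c2 + (d1 + d2) * N) * \<bar>s - t\<bar> powr \<beta>"
        using pos dN by (intro mult_right_mono) (auto simp: distrib_right)
      then show "\<bar>y s - y t\<bar> \<le> (c1 + c2 + (d1 + d2) * N) * \<bar>s - t\<bar> powr \<beta>"
        using b2[OF t s] by linarith
    qed
  qed (use pos in auto)
qed

lemma strong_solution_path_bounds:
  fixes H \<alpha> \<sigma> x T \<beta> :: real
  assumes H: "H < 1" and \<beta>: "0 < \<beta>" "\<beta> < H" and T: "0 < T" and \<sigma>: "0 < \<sigma>" and x: "0 \<le> x"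
  shows "\<exists>c d. 0 \<le> c \<and> 0 < d \<and> (\<forall>(M :: 'a measure) W X L.
      fractional_brownian_motion H M W \<and> strong_solution \<alpha> \<sigma> x M W X L \<longrightarrow>
      (AE \<omega> in M. let R = c + d * sqrt (1 / (H - \<beta>) + ln (1 + enn2real (dyadic_exp_sum H T W \<omega>))) in
        (\<forall>t\<in>{0..T}. \<bar>X t \<omega>\<bar> \<le> R) \<and>
        (\<forall>s\<in>{0..T}. \<forall>t\<in>{0..T}. \<bar>X t \<omega> - X s \<omega>\<bar> \<le> R * \<bar>t - s\<bar> powr \<beta>)))"
proof -
  have "\<beta> \<le> 1" using H \<beta> by simp
  from skorohod_path_bounds_linear[OF T \<beta>(1) this \<sigma> x, of \<alpha>] obtain c d where cd: "0 \<le> c" "0 < d"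
    and bd: "\<And>w y l N. skorohod_path \<alpha> \<sigma> x w y l \<Longrightarrow> 0 \<le> N \<Longrightarrow>
      (\<And>s t. s \<in> {0..T} \<Longrightarrow> t \<in> {0..T} \<Longrightarrow> \<bar>w t - w s\<bar> \<le> N * \<bar>t - s\<bar> powr \<beta>) \<Longrightarrow>
      (\<forall>t\<in>{0..T}. \<bar>y t\<bar> \<le> c + d * N) \<and>
      (\<forall>s\<in>{0..T}. \<forall>t\<in>{0..T}. \<bar>y t - y s\<bar> \<le> (c + d * N) * \<bar>t - s\<bar> powr \<beta>)"
    by blast
  \<comment> \<open>\<open>b\<close> collects the deterministic factors of the Hoelder constant of
    the driving path.\<close>
  define b where "b = chaining_const \<beta> * sqrt (4 * T powr (2 * (H - \<beta>)))"
  have b: "0 < b" using chaining_const_pos[OF \<beta>(1)] T by (simp add: b_def)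
  show ?thesis
  proof (rule exI[of _ c], rule exI[of _ "d * b"], intro conjI allI impI)
    fix M :: "'a measure" and W X L
    assume "fractional_brownian_motion H M W \<and> strong_solution \<alpha> \<sigma> x M W X L"
    then have fbm: "fractional_brownian_motion H M W" and sol: "strong_solution \<alpha> \<sigma> x M W X L"
      by blast+
    \<comment> \<open>Finite expectation makes the dyadic sum finite almost surely.\<close>
    have "AE \<omega> in M. dyadic_exp_sum H T W \<omega> \<noteq> \<infinity>"
      using borel_measurable_dyadic_exp_sum[OF fbm T] nn_integral_dyadic_exp_sum[OF fbm T]
      by (intro nn_integral_PInf_AE) auto
    moreover have "AE \<omega> in M. continuous_on {0..} (\<lambda>t. W t \<omega>)"
      using fbm unfolding fractional_brownian_motion_def by blast
    moreover have "AE \<omega> in M. skorohod_path \<alpha> \<sigma> x (\<lambda>t. W t \<omega>) (\<lambda>t. X t \<omega>) (\<lambda>t. L t \<omega>)"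
      using sol unfolding strong_solution_def by blast
    ultimately show "AE \<omega> in M. let R = c + d * b * sqrt (1 / (H - \<beta>) + ln (1 + enn2real (dyadic_exp_sum H T W \<omega>))) in
        (\<forall>t\<in>{0..T}. \<bar>X t \<omega>\<bar> \<le> R) \<and>
        (\<forall>s\<in>{0..T}. \<forall>t\<in>{0..T}. \<bar>X t \<omega> - X s \<omega>\<bar> \<le> R * \<bar>t - s\<bar> powr \<beta>)"
    proof eventually_elim
      case (elim \<omega>)
      define N where "N = b * sqrt (1 / (H - \<beta>) + ln (1 + enn2real (dyadic_exp_sum H T W \<omega>)))"
      have "dyadic_exp_sum H T W \<omega> < \<infinity>" using elim(1) by (simp add: less_top)
      from fbm_hoelder_bound[where W = W and \<omega> = \<omega>, OF \<beta> T elim(2) this]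
      have hw: "\<bar>W t \<omega> - W s \<omega>\<bar> \<le> N * \<bar>t - s\<bar> powr \<beta>" if "s \<in> {0..T}" "t \<in> {0..T}" for s t
        using that unfolding N_def b_def by (simp add: real_sqrt_mult mult.assoc)
      have "0 \<le> N" using b \<beta> by (simp add: N_def)
      from bd[OF elim(3) this hw] show ?case by (simp add: Let_def N_def mult.assoc)
    qed
  qed (use cd b in auto)
qed

text \<open>The generators of the completed filtration, events of \<open>W\<close> and null sets,
  all lie in the completion of \<open>M\<close>.\<close>

lemma strong_solution_measurable:
  assumes fbm: "fractional_brownian_motion H M W" and sol: "strong_solution \<alpha> \<sigma> x M W X L" and t: "0 \<le> t"
  shows "X t \<in> borel_measurable (completion M)"
proof -
  have X: "X t \<in> borel_measurable (completed_filtration M W t)"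
    using sol t unfolding strong_solution_def by blast
  let ?G = "{W s -` A \<inter> space M |s A. s \<in> {0..t} \<and> A \<in> sets borel} \<union> null_sets (completion M)"
  have G: "?G \<subseteq> sets (completion M)"
  proof (rule Un_least)
    show "{W s -` A \<inter> space M |s A. s \<in> {0..t} \<and> A \<in> sets borel} \<subseteq> sets (completion M)"
      using fbm_borel_measurable[OF fbm] by (auto intro!: sets_completionI_sets measurable_sets)
  qed auto
  \<comment> \<open>\<open>sigma\<close> has the intended measurable sets only if its generators are
    subsets of the space.\<close>
  have "?G \<subseteq> Pow (space M)" using G sets.sets_into_space[of _ "completion M"] by fastforce
  then have "sets (completed_filtration M W t) = sigma_sets (space M) ?G"
    by (simp add: completed_filtration_def)
  also have "\<dots> \<subseteq> sets (completion M)"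
    using sets.sigma_sets_subset[OF G] by simp
  finally have "sets (completed_filtration M W t) \<subseteq> sets (completion M)" .
  moreover have "space (completed_filtration M W t) = space (completion M)"
    by (simp add: completed_filtration_def space_measure_of_conv)
  ultimately show ?thesis using X measurable_mono[of borel borel "completed_filtration M W t" "completion M"]
    by blast
qed

section \<open>Almost sure Hoelder continuity for all exponents, and exponential moments of the
  norms\<close>

lemma hoelder_continuous_on_mono:
  fixes y :: "real \<Rightarrow> real"
  assumes y: "hoelder_continuous_on {0..T} \<gamma> y" and \<beta>: "\<beta> \<le> \<gamma>"
  shows "hoelder_continuous_on {0..T} \<beta> y"
proof -
  obtain C where C: "\<And>s t. s \<in> {0..T} \<Longrightarrow> t \<in> {0..T} \<Longrightarrow> \<bar>y t - y s\<bar> \<le> C * \<bar>t - s\<bar> powr \<gamma>"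
    using y unfolding hoelder_continuous_on_def by blast
  have "\<bar>y t - y s\<bar> \<le> \<bar>C\<bar> * T powr (\<gamma> - \<beta>) * \<bar>t - s\<bar> powr \<beta>"
    if st: "s \<in> {0..T}" "t \<in> {0..T}" for s t
  proof -
    have "\<bar>t - s\<bar> powr (\<gamma> - \<beta>) \<le> T powr (\<gamma> - \<beta>)" using st \<beta> by (intro powr_mono2) auto
    then have "\<bar>t - s\<bar> powr (\<gamma> - \<beta>) * \<bar>t - s\<bar> powr \<beta> \<le> T powr (\<gamma> - \<beta>) * \<bar>t - s\<bar> powr \<beta>"
      by (rule mult_right_mono) simp
    then have "\<bar>t - s\<bar> powr \<gamma> \<le> T powr (\<gamma> - \<beta>) * \<bar>t - s\<bar> powr \<beta>"
      by (simp add: powr_add[symmetric])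
    then have "\<bar>C\<bar> * \<bar>t - s\<bar> powr \<gamma> \<le> \<bar>C\<bar> * (T powr (\<gamma> - \<beta>) * \<bar>t - s\<bar> powr \<beta>)"
      by (rule mult_left_mono) simp
    moreover have "C * \<bar>t - s\<bar> powr \<gamma> \<le> \<bar>C\<bar> * \<bar>t - s\<bar> powr \<gamma>"
      by (intro mult_right_mono) auto
    ultimately show ?thesis using C[OF st] by (simp add: mult.assoc)
  qed
  then show ?thesis unfolding hoelder_continuous_on_def by blast
qed

text \<open>A single null set must serve uncountably many \<open>\<epsilon>\<close>. Countably many
  exponents approaching \<open>H\<close> suffice, since on a bounded interval Hoelder continuity
  passes to smaller exponents.\<close>

lemma strong_solution_hoelder:
  fixes H \<alpha> \<sigma> x T :: real and M :: "'a measure"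
  assumes H: "0 < H" "H < 1" and \<sigma>: "0 < \<sigma>" and x: "0 \<le> x" and T: "0 < T"
    and fbm: "fractional_brownian_motion H M W" and sol: "strong_solution \<alpha> \<sigma> x M W X L"
  shows "AE \<omega> in M. \<forall>\<epsilon>\<in>{0<..<H}. hoelder_continuous_on {0..T} (H - \<epsilon>) (\<lambda>t. X t \<omega>)"
proof -
  \<comment> \<open>The shift by 2 keeps \<open>\<delta> n\<close> strictly below \<open>H\<close>
    already for \<open>n = 0\<close>.\<close>
  define \<delta> where "\<delta> n = H / real (n + 2)" for n
  have \<delta>: "0 < \<delta> n" "\<delta> n < H" for n using H by (auto simp: \<delta>_def divide_less_eq)
  have "AE \<omega> in M. hoelder_continuous_on {0..T} (H - \<delta> n) (\<lambda>t. X t \<omega>)" for n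
  proof -
    have "0 < H - \<delta> n" "H - \<delta> n < H" using \<delta>[of n] by auto
    from strong_solution_path_bounds[OF H(2) this T \<sigma> x, where 'a = 'a and \<alpha> = \<alpha>]
    obtain c d where
      "AE \<omega> in M. let R = c + d * sqrt (1 / (H - (H - \<delta> n)) + ln (1 + enn2real (dyadic_exp_sum H T W \<omega>))) in
        (\<forall>t\<in>{0..T}. \<bar>X t \<omega>\<bar> \<le> R) \<and>
        (\<forall>s\<in>{0..T}. \<forall>t\<in>{0..T}. \<bar>X t \<omega> - X s \<omega>\<bar> \<le> R * \<bar>t - s\<bar> powr (H - \<delta> n))"
      using fbm sol by blast
    then show ?thesis
    proof eventually_elim
      case (elim \<omega>)
      then show ?case unfolding hoelder_continuous_on_def Let_def by blast
    qed
  qed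
  then have "AE \<omega> in M. \<forall>n. hoelder_continuous_on {0..T} (H - \<delta> n) (\<lambda>t. X t \<omega>)"
    by (simp add: AE_all_countable)
  then show ?thesis
  proof eventually_elim
    case (elim \<omega>)
    show ?case
    proof
      fix \<epsilon> assume \<epsilon>: "\<epsilon> \<in> {0<..<H}"
      obtain n where "H / \<epsilon> < real n" using reals_Archimedean2 by blast
      then have "H < real n * \<epsilon>" using \<epsilon> by (simp add: divide_less_eq)
      also have "\<dots> \<le> real (n + 2) * \<epsilon>" using \<epsilon> by (intro mult_right_mono) auto
      finally have "\<delta> n \<le> \<epsilon>" by (simp add: \<delta>_def divide_le_eq mult.commute)
      then show "hoelder_continuous_on {0..T} (H - \<epsilon>) (\<lambda>t. X t \<omega>)"
        using hoelder_continuous_on_mono elim by (metis diff_left_mono)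
    qed
  qed
qed

lemma strong_solution_exp_square_norms:
  fixes H \<alpha> \<sigma> x T \<beta> :: real
  assumes H: "H < 1" and \<beta>: "0 < \<beta>" "\<beta> < H" and T: "0 < T" and \<sigma>: "0 < \<sigma>" and x: "0 \<le> x"
  shows "\<exists>\<kappa>>0. \<forall>(M :: 'a measure) W X L.
      fractional_brownian_motion H M W \<and> strong_solution \<alpha> \<sigma> x M W X L \<longrightarrow>
      finite_expectation M (\<lambda>\<omega>. exp_ennreal (ennreal \<kappa> * (sup_norm T (\<lambda>t. X t \<omega>))\<^sup>2)) \<and>
      finite_expectation M (\<lambda>\<omega>. exp_ennreal (ennreal \<kappa> * (hoelder_norm \<beta> T (\<lambda>t. X t \<omega>))\<^sup>2))"
proof -
  obtain c d where c: "0 \<le> c" and d: "0 < d" and bd: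
    "\<forall>(M :: 'a measure) W X L. fractional_brownian_motion H M W \<and> strong_solution \<alpha> \<sigma> x M W X L \<longrightarrow>
      (AE \<omega> in M. let R = c + d * sqrt (1 / (H - \<beta>) + ln (1 + enn2real (dyadic_exp_sum H T W \<omega>))) in
        (\<forall>t\<in>{0..T}. \<bar>X t \<omega>\<bar> \<le> R) \<and>
        (\<forall>s\<in>{0..T}. \<forall>t\<in>{0..T}. \<bar>X t \<omega> - X s \<omega>\<bar> \<le> R * \<bar>t - s\<bar> powr \<beta>))"
    using strong_solution_path_bounds[OF H \<beta> T \<sigma> x, where 'a = 'a and \<alpha> = \<alpha>] by blast
  \<comment> \<open>By \<open>(c + d * u)\<^sup>2 \<le> 2 * c\<^sup>2 + 2 * d\<^sup>2 *
    u\<^sup>2\<close>, this \<open>\<kappa>\<close> brings the coefficient of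
    \<open>ln (1 + Z)\<close> to exactly 1; \<open>a\<close> collects the deterministic
    rest.\<close>
  define \<kappa> where "\<kappa> = 1 / (2 * d\<^sup>2)"
  define a where "a = c\<^sup>2 / d\<^sup>2 + 1 / (H - \<beta>)"
  have \<kappa>: "0 < \<kappa>" using d by (simp add: \<kappa>_def)
  have a: "0 \<le> a" using \<beta> by (simp add: a_def)
  show ?thesis
  proof (intro exI[of _ \<kappa>] conjI[OF \<kappa>] allI impI)
    fix M :: "'a measure" and W X L
    assume "fractional_brownian_motion H M W \<and> strong_solution \<alpha> \<sigma> x M W X L"
    then have fbm: "fractional_brownian_motion H M W" and sol: "strong_solution \<alpha> \<sigma> x M W X L"
      by blast+
    have M: "prob_space M" using fbm unfolding fractional_brownian_motion_def by blast
    define Z where "Z = dyadic_exp_sum H T W"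
    have Z: "Z \<in> borel_measurable M" "(\<integral>\<^sup>+\<omega>. Z \<omega> \<partial>M) < \<infinity>"
      unfolding Z_def by (rule borel_measurable_dyadic_exp_sum[OF fbm T], rule nn_integral_dyadic_exp_sum[OF fbm T])
    define R where "R \<omega> = c + d * sqrt (1 / (H - \<beta>) + ln (1 + enn2real (Z \<omega>)))" for \<omega>
    have R2: "r\<^sup>2 \<le> (a + ln (1 + enn2real (Z \<omega>))) / \<kappa>" if "0 \<le> r" "r \<le> R \<omega>" for r \<omega>
    proof -
      define u where "u = sqrt (1 / (H - \<beta>) + ln (1 + enn2real (Z \<omega>)))"
      have "r\<^sup>2 \<le> (c + d * u)\<^sup>2" using that by (intro power_mono) (auto simp: R_def u_def)
      also have "\<dots> \<le> 2 * c\<^sup>2 + 2 * d\<^sup>2 * u\<^sup>2"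
        using sum_squares_bound[of c "d * u"] by (simp add: power2_sum power_mult_distrib)
      also have "u\<^sup>2 = 1 / (H - \<beta>) + ln (1 + enn2real (Z \<omega>))"
        using \<beta> by (simp add: u_def)
      also have "2 * c\<^sup>2 + 2 * d\<^sup>2 * (1 / (H - \<beta>) + ln (1 + enn2real (Z \<omega>))) =
          (a + ln (1 + enn2real (Z \<omega>))) / \<kappa>"
        using d by (simp add: a_def \<kappa>_def field_simps)
      finally show ?thesis .
    qed
    have bounds: "AE \<omega> in M. (\<forall>t\<in>{0..T}. \<bar>X t \<omega>\<bar> \<le> R \<omega>) \<and>
        (\<forall>s\<in>{0..T}. \<forall>t\<in>{0..T}. \<bar>X t \<omega> - X s \<omega>\<bar> \<le> R \<omega> * \<bar>t - s\<bar> powr \<beta>)"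
      using bd[rule_format, OF conjI[OF fbm sol]] unfolding Let_def R_def Z_def .
    then have cont: "AE \<omega> in M. continuous_on {0..T} (\<lambda>t. X t \<omega>)"
      by eventually_elim (rule hoelder_imp_continuous_on[OF \<beta>(1)], blast)
    have X: "X t \<in> borel_measurable (completion M)" if "0 \<le> t" for t
      by (rule strong_solution_measurable[OF fbm sol that])
    have sup: "finite_expectation M (\<lambda>\<omega>. exp_ennreal (ennreal \<kappa> * (sup_norm T (\<lambda>t. X t \<omega>))\<^sup>2))"
      unfolding sup_norm_def
    proof (rule finite_expectation_exp_square_SUP[where G = "\<lambda>\<omega> r. \<bar>X r \<omega>\<bar>", OF M \<kappa> a _ _ Z])
      show "(\<lambda>\<omega>. \<bar>X r \<omega>\<bar>) \<in> borel_measurable (completion M)" if "r \<in> {0..T}" for r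
        using X[of r] that by (intro borel_measurable_abs) auto
      show "AE \<omega> in M. continuous_on {0..T} (\<lambda>r. \<bar>X r \<omega>\<bar>)"
        using cont by eventually_elim (rule continuous_on_rabs)
      show "AE \<omega> in M. \<forall>r\<in>{0..T}. 0 \<le> \<bar>X r \<omega>\<bar> \<and>
          \<bar>X r \<omega>\<bar>\<^sup>2 \<le> (a + ln (1 + enn2real (Z \<omega>))) / \<kappa>"
        using bounds by eventually_elim (intro ballI conjI abs_ge_zero R2, blast)
    qed
    define G where "G \<omega> p = \<bar>X (snd p) \<omega> - X (fst p) \<omega>\<bar> / \<bar>snd p - fst p\<bar> powr \<beta>" for \<omega> p
    \<comment> \<open>Excluding the diagonal keeps the denominator of \<open>G\<close> positive,
      hence \<open>G\<close> continuous on \<open>S\<close>.\<close>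
    define S where "S = {(\<theta>, r). 0 \<le> \<theta> \<and> \<theta> < r \<and> r \<le> T}"
    have S: "fst p \<in> {0..T}" "snd p \<in> {0..T}" "fst p < snd p" if "p \<in> S" for p
      using that by (auto simp: S_def)
    have "finite_expectation M (\<lambda>\<omega>. exp_ennreal (ennreal \<kappa> * (SUP p\<in>S. ennreal (G \<omega> p))\<^sup>2))"
    proof (rule finite_expectation_exp_square_SUP[OF M \<kappa> a _ _ Z])
      show "(\<lambda>\<omega>. G \<omega> p) \<in> borel_measurable (completion M)" if "p \<in> S" for p
        unfolding G_def using S[OF that] X[of "fst p"] X[of "snd p"]
        by (intro borel_measurable_divide borel_measurable_abs borel_measurable_diff) auto
      show "AE \<omega> in M. continuous_on S (G \<omega>)"
        using cont
      proof eventually_elim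
        case (elim \<omega>)
        have "continuous_on S (\<lambda>p. X (fst p) \<omega>)" "continuous_on S (\<lambda>p. X (snd p) \<omega>)"
          using S by (auto intro!: continuous_on_compose2[OF elim] continuous_intros)
        then show ?case unfolding G_def
          by (intro continuous_intros) (use S in fastforce)+
      qed
      show "AE \<omega> in M. \<forall>p\<in>S. 0 \<le> G \<omega> p \<and> (G \<omega> p)\<^sup>2 \<le> (a + ln (1 + enn2real (Z \<omega>))) / \<kappa>"
        using bounds
      proof eventually_elim
        case (elim \<omega>)
        show ?case
        proof
          fix p assume p: "p \<in> S"
          have "\<bar>X (snd p) \<omega> - X (fst p) \<omega>\<bar> \<le> R \<omega> * \<bar>snd p - fst p\<bar> powr \<beta>"
            using elim S[OF p] by blast
          then have "G \<omega> p \<le> R \<omega>" using S[OF p] by (simp add: G_def divide_le_eq)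
          moreover have "0 \<le> G \<omega> p" by (simp add: G_def)
          ultimately show "0 \<le> G \<omega> p \<and> (G \<omega> p)\<^sup>2 \<le> (a + ln (1 + enn2real (Z \<omega>))) / \<kappa>"
            using R2 by blast
        qed
      qed
    qed
    moreover have "hoelder_norm \<beta> T (\<lambda>t. X t \<omega>) = (SUP p\<in>S. ennreal (G \<omega> p))" for \<omega>
      unfolding hoelder_norm_def S_def G_def by (simp add: case_prod_beta')
    ultimately show "finite_expectation M (\<lambda>\<omega>. exp_ennreal (ennreal \<kappa> * (sup_norm T (\<lambda>t. X t \<omega>))\<^sup>2)) \<and>
      finite_expectation M (\<lambda>\<omega>. exp_ennreal (ennreal \<kappa> * (hoelder_norm \<beta> T (\<lambda>t. X t \<omega>))\<^sup>2))"
      using sup by simp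
  qed
qed

theorem lemma4p1:
  fixes H \<alpha> \<sigma> x :: real
  assumes "H \<in> {0<..<1/2} \<union> {1/2<..<1}" and "0 < \<sigma>" and "0 \<le> x"
  shows "(\<forall>(M :: 'a measure) W X L.
            fractional_brownian_motion H M W \<and> strong_solution \<alpha> \<sigma> x M W X L \<longrightarrow>
            (\<forall>T>0. AE \<omega> in M. \<forall>\<epsilon>\<in>{0<..<H}.
               hoelder_continuous_on {0..T} (H - \<epsilon>) (\<lambda>t. X t \<omega>)))
       \<and> (\<forall>T>0. \<forall>\<epsilon>\<in>{0<..<H}. \<exists>\<kappa>>0. \<forall>(M :: 'a measure) W X L.
            fractional_brownian_motion H M W \<and> strong_solution \<alpha> \<sigma> x M W X L \<longrightarrow>
            finite_expectation M
              (\<lambda>\<omega>. exp_ennreal (ennreal \<kappa> * (sup_norm T (\<lambda>t. X t \<omega>))\<^sup>2)) \<and>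
            finite_expectation M
              (\<lambda>\<omega>. exp_ennreal (ennreal \<kappa> * (hoelder_norm (H - \<epsilon>) T (\<lambda>t. X t \<omega>))\<^sup>2)))"
proof (intro conjI allI impI ballI)
  have H: "0 < H" "H < 1" using assms(1) by auto
  show "AE \<omega> in M. \<forall>\<epsilon>\<in>{0<..<H}. hoelder_continuous_on {0..T} (H - \<epsilon>) (\<lambda>t. X t \<omega>)"
    if "fractional_brownian_motion H M W \<and> strong_solution \<alpha> \<sigma> x M W X L" "0 < T"
    for M :: "'a measure" and W X L T
    using strong_solution_hoelder[OF H assms(2,3)] that by blast
  fix T \<epsilon> :: real assume T: "0 < T" and \<epsilon>: "\<epsilon> \<in> {0<..<H}"
  have "0 < H - \<epsilon>" "H - \<epsilon> < H" using \<epsilon> by auto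
  from strong_solution_exp_square_norms[OF H(2) this T assms(2,3)]
  show "\<exists>\<kappa>>0. \<forall>(M :: 'a measure) W X L.
            fractional_brownian_motion H M W \<and> strong_solution \<alpha> \<sigma> x M W X L \<longrightarrow>
            finite_expectation M
              (\<lambda>\<omega>. exp_ennreal (ennreal \<kappa> * (sup_norm T (\<lambda>t. X t \<omega>))\<^sup>2)) \<and>
            finite_expectation M
              (\<lambda>\<omega>. exp_ennreal (ennreal \<kappa> * (hoelder_norm (H - \<epsilon>) T (\<lambda>t. X t \<omega>))\<^sup>2))"
    .
qed

end
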